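(* Let $r\in\{1,\dots,N\}$ be a region with magnitude $m_r>0$ and parameter $\sigma_r>0$, and let $i\in\mathbb{N}$. Let $\tau^E_i$ be the hitting time (of $0$) of the $i$-th excursion of the energy accumulation process $E$ associated with the region $r$, where the levels of $E$ in the region $r$ are independent exponential random variables distributed as $h_r$, with $\mathbf{E}[h_r]=\eta_\varepsilon=m_r/\sigma_r$. Then $\tau^E_i\stackrel{d}{=}\mathcal{H}\circ h_r$. In particular, $$\mathbf{P}_0(\tau^E_i\in dz)=\int_0^\infty\frac{h}{z}\,\frac{e^{-(h-m_rz)^2/(4z)}}{\sqrt{4\pi z}}\,\frac{\sigma_r}{m_r}\,e^{-h(\sigma_r/m_r)}\,dh\,dz,\qquad z>0.$$
   Context: The energy accumulation process $E$ is built from successive excursions. During its $i$-th excursion, in region $r$, $E$ runs as a drifted Brownian motion $X^{\mu_i}$ on $(0,\infty)$ with negative drift $\mu_i=-m_r$ and generator $\varphi''+\mu_i\varphi'$ (driving Brownian motion of variance $2t$), started from a random exponential level distributed as $h_r$ and independent of the driving motion; the running (accumulation) time $\tau^E_i$ is the time this excursion takes to reach $0$. On reaching $0$, $E$ jumps to a new independent exponential level with the law of $h_r$, where it is held for a random time before the next excursion starts. $\mathcal{H}=\{\mathcal{H}_t\}_{t\ge0}$ is the tempered stable subordinator started at $0$ with $\mathbf{E}_0[e^{-\lambda\mathcal{H}_t}]=e^{-t\Phi_r(\lambda)}$, $\Phi_r(\lambda)=\sqrt{\lambda+\theta_r}-\sqrt{\theta_r}$, $\theta_r=(m_r/2)^2$,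 $\lambda>0$. $\mathcal{H}\circ h_r=\mathcal{H}_{h_r}$ with $h_r$ independent of $\mathcal{H}$, and $\stackrel{d}{=}$ is equality in distribution. *)

theory Defs
  imports "HOL-Probability.Probability"
begin

definition independent_increments :: "'a measure \<Rightarrow> (real \<Rightarrow> 'a \<Rightarrow> real) \<Rightarrow> bool" where
  "independent_increments M X \<longleftrightarrow>
     (\<forall>n (t :: nat \<Rightarrow> real). 0 \<le> t 0 \<longrightarrow> mono t \<longrightarrow>
        prob_space.indep_vars M (\<lambda>_. borel) (\<lambda>k \<omega>. X (t (Suc k)) \<omega> - X (t k) \<omega>) {..<n})"

definition path_of :: "(real \<Rightarrow> 'a \<Rightarrow> real) \<Rightarrow> 'a \<Rightarrow> real \<Rightarrow> real" where
  "path_of X \<omega> = (\<lambda>t\<in>{0..}. X t \<omega>)"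

text \<open>Independence of a real random variable \<open>Y\<close> and a whole process \<open>X\<close> on \<open>[0,\<infinity>)\<close>, seen as a
  random element of the product space. The constant \<open>indep_var\<close> requires both random variables to
  have the same type, so the generated \<open>\<sigma>\<close>-algebras are compared directly.\<close>

definition indep_of_process ::
    "'a measure \<Rightarrow> ('a \<Rightarrow> real) \<Rightarrow> (real \<Rightarrow> 'a \<Rightarrow> real) \<Rightarrow> bool" where
  "indep_of_process M Y X \<longleftrightarrow>
     prob_space.indep_set M {Y -` A \<inter> space M |A. A \<in> sets borel}
       {path_of X -` A \<inter> space M |A. A \<in> sets (Pi\<^sub>M {0..} (\<lambda>_. borel))}"

definition eq_in_distribution ::
    "'a measure \<Rightarrow> ('a \<Rightarrow> 'c) \<Rightarrow> 'b measure \<Rightarrow> ('b \<Rightarrow> 'c) \<Rightarrow> 'c measure \<Rightarrow> bool" where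
  "eq_in_distribution M X M' Y S \<longleftrightarrow>
     X \<in> measurable M S \<and> Y \<in> measurable M' S \<and> distr M S X = distr M' S Y"

definition exponential_with_mean :: "'a measure \<Rightarrow> ('a \<Rightarrow> real) \<Rightarrow> real \<Rightarrow> bool" where
  "exponential_with_mean M X \<eta> \<longleftrightarrow>
     (\<exists>l>0. distributed M lborel X (exponential_density l)) \<and> prob_space.expectation M X = \<eta>"

text \<open>Brownian motion started at 0 with the normalisation Var \<open>B\<^sub>t = 2t\<close>, whose generator
  is \<open>\<phi>''\<close>, without the factor 1/2.\<close>

locale brownian_motion_2 = prob_space M for M :: "'a measure" +
  fixes B :: "real \<Rightarrow> 'a \<Rightarrow> real"
  assumes measurable_at: "\<And>t. 0 \<le> t \<Longrightarrow> random_variable borel (B t)"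
    and start_0: "\<And>\<omega>. \<omega> \<in> space M \<Longrightarrow> B 0 \<omega> = 0"
    and continuous_paths: "\<And>\<omega>. \<omega> \<in> space M \<Longrightarrow> continuous_on {0..} (\<lambda>t. B t \<omega>)"
    and indep_increments: "independent_increments M B"
    and normal_increments: "\<And>s t. 0 \<le> s \<Longrightarrow> s < t \<Longrightarrow>
          distributed M lborel (\<lambda>\<omega>. B t \<omega> - B s \<omega>) (normal_density 0 (sqrt (2 * (t - s))))"

definition tempered_exponent :: "real \<Rightarrow> real \<Rightarrow> real" where
  "tempered_exponent \<theta> u = sqrt (u + \<theta>) - sqrt \<theta>"

locale tempered_stable_subordinator = prob_space M for M :: "'a measure" +
  fixes \<theta> :: real and H :: "real \<Rightarrow> 'a \<Rightarrow> real"
  assumes measurable_at: "\<And>t. 0 \<le> t \<Longrightarrow> random_variable borel (H t)"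
    and start_0: "\<And>\<omega>. \<omega> \<in> space M \<Longrightarrow> H 0 \<omega> = 0"
    and nondecreasing_paths: "\<And>\<omega>. \<omega> \<in> space M \<Longrightarrow> mono_on {0..} (\<lambda>t. H t \<omega>)"
    and right_continuous_paths: "\<And>\<omega> t. \<omega> \<in> space M \<Longrightarrow> 0 \<le> t \<Longrightarrow>
          continuous (at_right t) (\<lambda>s. H s \<omega>)"
    and indep_increments: "independent_increments M H"
    and stationary_increments: "\<And>s t. 0 \<le> s \<Longrightarrow> 0 \<le> t \<Longrightarrow>
          distr M borel (\<lambda>\<omega>. H (s + t) \<omega> - H s \<omega>) = distr M borel (H t)"
    and laplace: "\<And>t u. 0 \<le> t \<Longrightarrow> 0 < u \<Longrightarrow>
          expectation (\<lambda>\<omega>. exp (- u * H t \<omega>)) = exp (- t * tempered_exponent \<theta> u)"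

text \<open>First time a path reaches 0; it is \<open>\<infinity>\<close> if the path never does.\<close>

definition hitting_time_0 :: "(real \<Rightarrow> real) \<Rightarrow> ereal" where
  "hitting_time_0 x = (INF t\<in>{t. 0 \<le> t \<and> x t = 0}. ereal t)"

text \<open>Excursion \<open>i\<close> takes place in the region \<open>reg i\<close>, starts at the level \<open>L i\<close> and is driven by
  \<open>B i\<close>; \<open>m j\<close> is the magnitude of the region \<open>j\<close>.\<close>

definition excursion ::
    "(nat \<Rightarrow> real) \<Rightarrow> (nat \<Rightarrow> nat) \<Rightarrow> (nat \<Rightarrow> 'a \<Rightarrow> real) \<Rightarrow> (nat \<Rightarrow> real \<Rightarrow> 'a \<Rightarrow> real) \<Rightarrow>
     nat \<Rightarrow> real \<Rightarrow> 'a \<Rightarrow> real" where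
  "excursion m reg L B i t \<omega> = L i \<omega> + (- m (reg i)) * t + B i t \<omega>"

definition accumulation_time ::
    "(nat \<Rightarrow> real) \<Rightarrow> (nat \<Rightarrow> nat) \<Rightarrow> (nat \<Rightarrow> 'a \<Rightarrow> real) \<Rightarrow> (nat \<Rightarrow> real \<Rightarrow> 'a \<Rightarrow> real) \<Rightarrow>
     nat \<Rightarrow> 'a \<Rightarrow> ereal" where
  "accumulation_time m reg L B i \<omega> = hitting_time_0 (\<lambda>t. excursion m reg L B i t \<omega>)"

text \<open>Starting times of the successive excursions; \<open>D i\<close> is the time for which the process is held
  after excursion \<open>i\<close>.\<close>

primrec excursion_start ::
    "(nat \<Rightarrow> real) \<Rightarrow> (nat \<Rightarrow> nat) \<Rightarrow> (nat \<Rightarrow> 'a \<Rightarrow> real) \<Rightarrow> (nat \<Rightarrow> real \<Rightarrow> 'a \<Rightarrow> real) \<Rightarrow>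
     (nat \<Rightarrow> 'a \<Rightarrow> real) \<Rightarrow> nat \<Rightarrow> 'a \<Rightarrow> ereal" where
  "excursion_start m reg L B D 0 \<omega> = 0"
| "excursion_start m reg L B D (Suc i) \<omega> =
     excursion_start m reg L B D i \<omega> + accumulation_time m reg L B i \<omega> + ereal (D i \<omega>)"

locale energy_accumulation = prob_space M for M :: "'a measure" +
  fixes N :: nat
    and m \<sigma> :: "nat \<Rightarrow> real"
    and reg :: "nat \<Rightarrow> nat"
    and L :: "nat \<Rightarrow> 'a \<Rightarrow> real"
    and B :: "nat \<Rightarrow> real \<Rightarrow> 'a \<Rightarrow> real"
    and D :: "nat \<Rightarrow> 'a \<Rightarrow> real"
    and E :: "real \<Rightarrow> 'a \<Rightarrow> real"
  assumes m_pos: "\<And>j. j \<in> {1..N} \<Longrightarrow> 0 < m j"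
    and \<sigma>_pos: "\<And>j. j \<in> {1..N} \<Longrightarrow> 0 < \<sigma> j"
    and region: "\<And>i. reg i \<in> {1..N}"
    and level_law: "\<And>i. exponential_with_mean M (L i) (m (reg i) / \<sigma> (reg i))"
    and indep_levels: "indep_vars (\<lambda>_. borel) L UNIV"
    and driving_motion: "\<And>i. brownian_motion_2 M (B i)"
    and indep_level_motion: "\<And>i. indep_of_process M (L i) (B i)"
    and holding_measurable: "\<And>i. random_variable borel (D i)"
    and holding_nonneg: "\<And>i \<omega>. \<omega> \<in> space M \<Longrightarrow> 0 \<le> D i \<omega>"
    and running: "\<And>i t \<omega>. \<omega> \<in> space M \<Longrightarrow>
          excursion_start m reg L B D i \<omega> \<le> ereal t \<Longrightarrow>
          ereal t < excursion_start m reg L B D i \<omega> + accumulation_time m reg L B i \<omega> \<Longrightarrow>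
          E t \<omega> = excursion m reg L B i (t - real_of_ereal (excursion_start m reg L B D i \<omega>)) \<omega>"
    and held: "\<And>i t \<omega>. \<omega> \<in> space M \<Longrightarrow>
          excursion_start m reg L B D i \<omega> + accumulation_time m reg L B i \<omega> \<le> ereal t \<Longrightarrow>
          ereal t < excursion_start m reg L B D (Suc i) \<omega> \<Longrightarrow>
          E t \<omega> = L (Suc i) \<omega>"

end

theory Submission
  imports Defs "HOL-Real_Asymp.Real_Asymp"
begin

text \<open>Both times are characterised by their Laplace transforms, which equal
  \<open>l / (l + \<Phi>(u))\<close> with \<open>l = \<sigma>\<^sub>r / m\<^sub>r\<close>. For the excursion, optional stopping of the exponential martingale
  \<open>exp (-\<Phi>(u) B\<^sub>t - \<Phi>(u)\<^sup>2 t)\<close> along a grid gives the transform \<open>exp (-x \<Phi>(u))\<close> of the hitting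
  time from a fixed level \<open>x\<close>; for the density, it is the transform of the inverse Gaussian law. The
  transform at the positive integers consists of the moments of the bounded variable
  \<open>exp (-\<tau>)\<close>, hence determines the law of \<open>\<tau>\<close>, including a possible atom at \<open>\<infinity>\<close>.\<close>

subsection \<open>Moments and inverse Gaussian integrals\<close>

text \<open>The rate \<open>\<Phi>(u)\<close> is the nonnegative root of
  \<open>\<Phi>\<^sup>2 + m * \<Phi> = u\<close>. With parameter \<open>-\<Phi>\<close> the
  exponential martingale of the driving motion becomes, up to the factor
  \<open>exp (x * \<Phi>)\<close>, the process \<open>exp (-\<Phi> * X) * exp (-u * t)\<close> of
  the drifted path \<open>X\<close>, and at the hitting time only the discount
  \<open>exp (-u * t)\<close> is left of it. A grid misses the hitting time in two ways: the path
  may touch 0 between grid points, or already be below 0 where it is stopped. Each defect gets its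
  own one-sided estimate: stopping at a positive level yields the upper bound, stopping at level 0
  the lower bound. For a fixed level \<open>x\<close> the subordinator at time \<open>x\<close> has
  the transform \<open>exp (-x * \<Phi>)\<close> as well, so the averaging over the exponential
  level is one argument for both sides. Times are compared as elements of [0, \<infinity>] because
  finiteness of the hitting time is not known beforehand; it follows from the equality of
  laws.\<close>

lemma bounded_moments_unique:
  fixes X :: "'a \<Rightarrow> real" and Y :: "'b \<Rightarrow> real"
  assumes "prob_space M" "prob_space N"
    and [measurable]: "X \<in> borel_measurable M" "Y \<in> borel_measurable N"
    and X: "\<And>\<omega>. \<omega> \<in> space M \<Longrightarrow> \<bar>X \<omega>\<bar> \<le> 1" and Y: "\<And>\<omega>. \<omega> \<in> space N \<Longrightarrow> \<bar>Y \<omega>\<bar> \<le> 1"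
    and eq: "\<And>n. (\<integral>\<omega>. X \<omega> ^ n \<partial>M) = (\<integral>\<omega>. Y \<omega> ^ n \<partial>N)"
  shows "distr M borel X = distr N borel Y"
proof -
  interpret M: prob_space M by fact
  interpret N: prob_space N by fact
  have iX: "integrable M (\<lambda>\<omega>. X \<omega> ^ k)" for k
    using X by (intro M.integrable_const_bound[where B=1]) (auto intro!: AE_I2 simp: power_abs power_le_one)
  have iY: "integrable N (\<lambda>\<omega>. Y \<omega> ^ k)" for k
    using Y by (intro N.integrable_const_bound[where B=1]) (auto intro!: AE_I2 simp: power_abs power_le_one)
  have bX: "(\<integral>\<omega>. \<bar>X \<omega>\<bar> ^ n \<partial>M) \<le> 1" for n
    using X by (intro M.integral_le_const integrable_abs[OF iX, unfolded power_abs]) (auto intro!: AE_I2 simp: power_le_one)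
  have bY: "(\<integral>\<omega>. \<bar>Y \<omega>\<bar> ^ n \<partial>N) \<le> 1" for n
    using Y by (intro N.integral_le_const integrable_abs[OF iY, unfolded power_abs]) (auto intro!: AE_I2 simp: power_le_one)
  \<comment> \<open>The Taylor polynomial of a characteristic function uses the moments only, and
    its remainder is at most \<open>2 * \<bar>t\<bar>^n / fact n\<close> times the n-th absolute
    moment. These moments are at most 1, so the remainder vanishes for every fixed
    \<open>t\<close>.\<close>
  have "char (distr M borel X) = char (distr N borel Y)"
  proof
    fix t :: real
    let ?a = "char (distr M borel X) t" and ?b = "char (distr N borel Y) t"
    have le: "cmod (?a - ?b) \<le> 4 * (\<bar>t\<bar> ^ n / fact n)" for n
    proof -
      let ?S = "\<Sum>k \<le> n. ((\<i> * t)^k / fact k) * (\<integral>\<omega>. X \<omega> ^ k \<partial>M)"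
      have 1: "cmod (?a - ?S) \<le> (2 * \<bar>t\<bar>^n / fact n) * 1"
        by (rule order_trans[OF M.char_approx1'[where n=n and X=X]])
           (auto simp: iX intro!: divide_right_mono mult_left_le bX)
      have 2: "cmod (?b - ?S) \<le> (2 * \<bar>t\<bar>^n / fact n) * 1"
        unfolding eq
        by (rule order_trans[OF N.char_approx1'[where n=n and X=Y]])
           (auto simp: iY intro!: divide_right_mono mult_left_le bY)
      have "cmod (?a - ?b) \<le> cmod (?a - ?S) + cmod (?b - ?S)"
        using norm_triangle_ineq4[of "?a - ?S" "?b - ?S"] by simp
      then show ?thesis
        using 1 2 unfolding mult_1_right times_divide_eq_right[symmetric] by linarith
    qed
    have "(\<lambda>n. \<bar>t\<bar> ^ n / fact n) \<longlonglongrightarrow> 0"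
      using summable_LIMSEQ_zero[OF summable_exp[of "\<bar>t\<bar>"]] by (simp add: field_simps)
    from tendsto_mult_left[OF this, of 4] have "(\<lambda>n. 4 * (\<bar>t\<bar> ^ n / fact n)) \<longlonglongrightarrow> 0"
      by simp
    with le have "cmod (?a - ?b) \<le> 0"
      by (intro LIMSEQ_le_const[of _ "0::real"]) auto
    then show "?a = ?b" by simp
  qed
  then show ?thesis
    by (intro Levy_uniqueness M.real_distribution_distr N.real_distribution_distr) auto
qed

section \<open>The inverse Gaussian law and its exponential tilts\<close>

lemma std_normal_cdf_has_derivative:
  "(cdf std_normal_distribution has_real_derivative std_normal_density y) (at y)"
proof -
  interpret N: real_distribution std_normal_distribution by (rule real_dist_normal_dist)
  \<comment> \<open>Any base point left of \<open>y\<close> would do: \<open>y\<close> is then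
    interior to the interval of integration, and the derivative within the interval is a full
    derivative.\<close>
  define K where "K = y - 1"
  have *: "cdf std_normal_distribution z = cdf std_normal_distribution K + integral {K..z} std_normal_density"
    if "z \<in> {K<..<y+1}" for z
  proof -
    have "K < z" using that by auto
    then have "cdf std_normal_distribution z - cdf std_normal_distribution K = measure std_normal_distribution {K<..z}"
      by (rule N.cdf_diff_eq)
    also have "\<dots> = (LINT x|lborel. std_normal_density x * indicator {K<..z} x)"
    proof -
      have "emeasure std_normal_distribution {K<..z} = (\<integral>\<^sup>+x. ennreal (std_normal_density x * indicator {K<..z} x) \<partial>lborel)"
        by (subst emeasure_density) (auto intro!: nn_integral_cong simp: indicator_def)
      also have "\<dots> = ennreal (LINT x|lborel. std_normal_density x * indicator {K<..z} x)"
        by (intro nn_integral_eq_integral integrable_real_mult_indicator) auto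
      finally show ?thesis
        by (simp add: measure_def)
    qed
    also have "\<dots> = set_lebesgue_integral lborel {K<..z} std_normal_density"
      by (simp add: set_lebesgue_integral_def mult.commute)
    also have "\<dots> = integral {K<..z} std_normal_density"
      by (intro set_borel_integral_eq_integral) (unfold set_integrable_def, rule integrable_mult_indicator, auto)
    also have "\<dots> = integral {K..z} std_normal_density"
      by (rule integral_subset_negligible) (auto intro: negligible_subset[of "{K}"])
    finally show ?thesis by simp
  qed
  have "continuous_on {K..y+1} std_normal_density"
    unfolding normal_density_def by (intro continuous_intros) auto
  then have "((\<lambda>z. integral {K..z} std_normal_density) has_real_derivative std_normal_density y) (at y within {K..y+1})"
    by (rule integral_has_real_derivative) (auto simp: K_def)
  then have "((\<lambda>z. integral {K..z} std_normal_density) has_real_derivative std_normal_density y) (at y)"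
    by (subst (asm) at_within_Icc_at) (auto simp: K_def)
  then have "((\<lambda>z. cdf std_normal_distribution K + integral {K..z} std_normal_density) has_real_derivative std_normal_density y) (at y)"
    by (auto intro!: derivative_eq_intros)
  then show ?thesis
    by (rule DERIV_cong_ev[OF refl _ refl, THEN iffD2, rotated])
       (use * in \<open>auto simp: eventually_at K_def dist_real_def intro!: eventually_nhds_in_open[of "{K<..<y+1}", THEN eventually_mono]\<close>)
qed

text \<open>The integrand is the density of the first time at which a Brownian motion of variance 2t
  with drift \<open>-a\<close>, started at \<open>x\<close>, reaches 0; the drift makes the hit
  certain, whence mass 1. Analytically, there is an explicit antiderivative \<open>F\<close> running
  from 0 to 1, whose term with \<open>exp (a * x)\<close> is the reflection term corrected for the
  drift.\<close>

lemma nn_integral_inverse_gaussian: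
  fixes x a :: real
  assumes x: "0 < x" and a: "0 < a"
  shows "(\<integral>\<^sup>+z\<in>{0<..}. ennreal (x / z * (exp (- (x - a * z)\<^sup>2 / (4 * z)) / sqrt (4 * pi * z))) \<partial>lborel) = 1"
proof -
  interpret N: real_distribution std_normal_distribution by (rule real_dist_normal_dist)
  let ?Q = "cdf std_normal_distribution"
  define f where "f z = x / z * (exp (- (x - a * z)\<^sup>2 / (4 * z)) / sqrt (4 * pi * z))" for z
  \<comment> \<open>\<open>F\<close> is the distribution function of the first passage time.\<close>
  define u where "u z = (a * z - x) / sqrt (2 * z)" for z
  define v where "v z = - (a * z + x) / sqrt (2 * z)" for z
  define F where "F z = ?Q (u z) + exp (a * x) * ?Q (v z)" for z
  have f0: "0 \<le> f z" if "0 < z" for z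
    using that x by (simp add: f_def)
  have DF: "DERIV F z :> f z" if z: "0 < z" for z
  proof -
    define s where "s = sqrt (2 * z)"
    have s: "s > 0" "s\<^sup>2 = 2 * z" using z by (auto simp: s_def)
    have Ds: "((\<lambda>z. sqrt (2 * z)) has_real_derivative 1 / s) (at z)"
      using z by (auto intro!: derivative_eq_intros simp: s_def field_simps)
    have Du: "(u has_real_derivative (a * s - (a * z - x) / s) / s\<^sup>2) (at z)"
    proof -
      have "((\<lambda>z. a * z - x) has_real_derivative a) (at z)"
        by (auto intro!: derivative_eq_intros)
      from DERIV_divide[OF this Ds] show ?thesis
        using s by (simp add: u_def[abs_def] s_def[symmetric] power2_eq_square)
    qed
    have Dv: "(v has_real_derivative (- a * s + (a * z + x) / s) / s\<^sup>2) (at z)"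
    proof -
      have "((\<lambda>z. - (a * z + x)) has_real_derivative - a) (at z)"
        by (auto intro!: derivative_eq_intros)
      from DERIV_divide[OF this Ds]
      have "(v has_real_derivative (- a * s - - (a * z + x) * (1 / s)) / (s * s)) (at z)"
        using s(1) by (simp only: v_def[abs_def] s_def[symmetric])
      moreover have "(- a * s - - (a * z + x) * (1 / s)) / (s * s) = (- a * s + (a * z + x) / s) / s\<^sup>2"
        using s(1) by (simp only: power2_eq_square mult_minus_left mult_1_right times_divide_eq_right minus_divide_left[symmetric] minus_mult_left[symmetric] diff_minus_eq_add)
      ultimately show ?thesis by simp
    qed
    have D: "DERIV F z :> std_normal_density (u z) * ((a * s - (a * z - x) / s) / s\<^sup>2)
        + exp (a * x) * (std_normal_density (v z) * ((- a * s + (a * z + x) / s) / s\<^sup>2))"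
      unfolding F_def
      by (intro DERIV_add DERIV_cmult DERIV_chain2[OF std_normal_cdf_has_derivative] Du Dv)
    have uu: "(u z)\<^sup>2 / 2 = (x - a * z)\<^sup>2 / (4 * z)"
      using z by (simp add: u_def power_divide power2_commute)
    have "(v z)\<^sup>2 / 2 = (a * z + x)\<^sup>2 / (4 * z)"
      using z by (simp add: v_def power_divide power2_commute) (simp add: power2_eq_square algebra_simps)
    \<comment> \<open>Since
      \<open>(a * z + x)\<^sup>2 - (x - a * z)\<^sup>2 = 4 * a * x * z\<close>, the weight
      \<open>exp (a * x)\<close> turns the normal density at \<open>v z\<close> into the one at
      \<open>u z\<close>. Both terms of the derivative then share one Gaussian factor, and their
      parts with \<open>a * s\<close> cancel.\<close>
    then have vv: "a * x - (v z)\<^sup>2 / 2 = - ((x - a * z)\<^sup>2 / (4 * z))"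
      using z by (simp add: field_simps power2_eq_square)
    have e1: "std_normal_density (u z) = exp (- ((x - a * z)\<^sup>2 / (4 * z))) / sqrt (2 * pi)"
      using uu by (simp add: std_normal_density_def)
    have e2: "exp (a * x) * std_normal_density (v z) = exp (- ((x - a * z)\<^sup>2 / (4 * z))) / sqrt (2 * pi)"
      unfolding vv[symmetric] unfolding diff_conv_add_uminus exp_add by (simp add: std_normal_density_def)
    have e3: "sqrt (4 * pi * z) = sqrt (2 * pi) * s"
      by (simp add: s_def real_sqrt_mult[symmetric])
    have e4: "(a * s - (a * z - x) / s) / s\<^sup>2 + (- a * s + (a * z + x) / s) / s\<^sup>2 = x / z / s"
      unfolding s(2) using s z by (simp add: field_simps)
    have "std_normal_density (u z) * ((a * s - (a * z - x) / s) / s\<^sup>2)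
        + exp (a * x) * (std_normal_density (v z) * ((- a * s + (a * z + x) / s) / s\<^sup>2)) =
        std_normal_density (u z) * ((a * s - (a * z - x) / s) / s\<^sup>2 + (- a * s + (a * z + x) / s) / s\<^sup>2)"
      unfolding mult.assoc[symmetric] e2 e1 by (simp only: distrib_left)
    also have "\<dots> = f z"
      unfolding e4 e1 f_def e3 by (simp add: mult_ac)
    finally show ?thesis using D by simp
  qed
  have u0: "filterlim u at_bot (at_right 0)" and v0: "filterlim v at_bot (at_right 0)"
    and ui: "filterlim u at_top at_top" and vi: "filterlim v at_bot at_top"
    using x a unfolding u_def v_def by real_asymp+
  have A: "(F \<longlongrightarrow> 0 + exp (a * x) * 0) (at_right 0)"
    unfolding F_def
    by (intro tendsto_intros filterlim_compose[OF N.cdf_lim_at_bot] u0 v0)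
  have B: "(F \<longlongrightarrow> 1 + exp (a * x) * 0) at_top"
    unfolding F_def
    by (intro tendsto_intros filterlim_compose[OF N.cdf_lim_at_bot] filterlim_compose[OF N.cdf_lim_at_top_prob] ui vi)
  have A': "((F \<circ> real_of_ereal) \<longlongrightarrow> 0) (at_right (0::ereal))"
    using A unfolding zero_ereal_def ereal_tendsto_simps by simp
  have B': "((F \<circ> real_of_ereal) \<longlongrightarrow> 1) (at_left \<infinity>)"
    using B unfolding ereal_tendsto_simps by simp
  have c: "isCont f z" if "0 < z" for z
    using that unfolding f_def by (intro continuous_intros) auto
  have I: "set_integrable lborel (einterval 0 \<infinity>) f" "(LBINT z=0..\<infinity>. f z) = 1 - 0"
    by (rule interval_integral_FTC_nonneg[OF _ _ _ _ A' B'];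
        use DF c f0 in \<open>auto simp: zero_ereal_def\<close>)+
  have e: "einterval 0 \<infinity> = {0<..}" by (auto simp: einterval_def zero_ereal_def)
  have "(\<integral>\<^sup>+z\<in>{0<..}. ennreal (f z) \<partial>lborel) = (\<integral>\<^sup>+z. ennreal (indicator {0<..} z *\<^sub>R f z) \<partial>lborel)"
    by (intro nn_integral_cong) (auto simp: indicator_def)
  also have "\<dots> = ennreal (LINT z:{0<..}|lborel. f z)"
    unfolding set_lebesgue_integral_def using I(1) f0
    by (intro nn_integral_eq_integral) (auto simp: set_integrable_def e indicator_def)
  also have "(LINT z:{0<..}|lborel. f z) = 1"
    using I(2) by (simp add: interval_lebesgue_integral_def e)
  finally show ?thesis by (simp add: f_def)
qed

text \<open>Exponential tilting: the factor \<open>exp (- u * z)\<close> replaces the drift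
  \<open>m\<close> by \<open>a\<close> with \<open>a\<^sup>2 = m\<^sup>2 + 4 * u\<close>, at the
  price of the constant \<open>exp (- x * ((a - m) / 2))\<close>. The tilted density again has mass
  1, and \<open>(a - m) / 2\<close> is the tempered exponent.\<close>

lemma nn_integral_exp_inverse_gaussian:
  fixes x m u :: real
  assumes x: "0 < x" and m: "0 < m" and u: "0 \<le> u"
  shows "(\<integral>\<^sup>+z\<in>{0<..}. ennreal (x / z * (exp (- (x - m * z)\<^sup>2 / (4 * z)) / sqrt (4 * pi * z)) * exp (- u * z)) \<partial>lborel)
    = ennreal (exp (- x * tempered_exponent ((m / 2)\<^sup>2) u))"
proof -
  define a where "a = 2 * sqrt (u + (m / 2)\<^sup>2)"
  have a: "0 < a" "a\<^sup>2 = 4 * u + m\<^sup>2"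
    using u m by (auto simp: a_def power_mult_distrib power_divide intro!: add_nonneg_pos)
  have p: "tempered_exponent ((m / 2)\<^sup>2) u = (a - m) / 2"
    using m by (simp add: tempered_exponent_def a_def)
  have *: "- (x - m * z)\<^sup>2 / (4 * z) + - u * z = - (x - a * z)\<^sup>2 / (4 * z) + - x * ((a - m) / 2)" if "0 < z" for z
  proof -
    have "4 * u * z\<^sup>2 = a\<^sup>2 * z\<^sup>2 - m\<^sup>2 * z\<^sup>2" using a(2) by (simp add: algebra_simps)
    then show ?thesis using that by (simp add: field_simps power2_eq_square)
  qed
  have "(\<integral>\<^sup>+z\<in>{0<..}. ennreal (x / z * (exp (- (x - m * z)\<^sup>2 / (4 * z)) / sqrt (4 * pi * z)) * exp (- u * z)) \<partial>lborel)
     = (\<integral>\<^sup>+z. ennreal (exp (- x * ((a - m) / 2))) * (ennreal (x / z * (exp (- (x - a * z)\<^sup>2 / (4 * z)) / sqrt (4 * pi * z))) * indicator {0<..} z) \<partial>lborel)"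
  proof (intro nn_integral_cong)
    fix z :: real
    show "ennreal (x / z * (exp (- (x - m * z)\<^sup>2 / (4 * z)) / sqrt (4 * pi * z)) * exp (- u * z)) * indicator {0<..} z
      = ennreal (exp (- x * ((a - m) / 2))) * (ennreal (x / z * (exp (- (x - a * z)\<^sup>2 / (4 * z)) / sqrt (4 * pi * z))) * indicator {0<..} z)"
    proof (cases "0 < z")
      case True
      have "exp (- (x - m * z)\<^sup>2 / (4 * z)) * exp (- u * z) = exp (- (x - a * z)\<^sup>2 / (4 * z)) * exp (- x * ((a - m) / 2))"
        unfolding exp_add[symmetric] *[OF True] ..
      then have "x / z * (exp (- (x - m * z)\<^sup>2 / (4 * z)) / sqrt (4 * pi * z)) * exp (- u * z)
        = exp (- x * ((a - m) / 2)) * (x / z * (exp (- (x - a * z)\<^sup>2 / (4 * z)) / sqrt (4 * pi * z)))"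
        by (simp add: field_simps)
      then show ?thesis by (simp only: ennreal_mult' exp_ge_zero mult.assoc)
    qed simp
  qed
  also have "\<dots> = ennreal (exp (- x * ((a - m) / 2)))"
    by (subst nn_integral_cmult) (measurable, simp only: nn_integral_inverse_gaussian[OF x a(1)] mult_1_right)
  finally show ?thesis by (simp add: p)
qed

text \<open>Tilting by \<open>c\<close> raises the rate from \<open>l\<close> to
  \<open>l + c\<close>; the ratio of the normalising constants is the value.\<close>

lemma nn_integral_exp_exponential_density:
  fixes l c :: real
  assumes "0 < l" "0 \<le> c"
  shows "(\<integral>\<^sup>+x. ennreal (exponential_density l x) * ennreal (exp (- x * c)) \<partial>lborel) = ennreal (l / (l + c))"
proof -
  interpret prob_space "density lborel (exponential_density (l + c))"
    using assms by (intro prob_space_exponential_density) auto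
  have "(\<integral>\<^sup>+x. ennreal (exponential_density l x) * ennreal (exp (- x * c)) \<partial>lborel) =
    (\<integral>\<^sup>+x. ennreal (l / (l + c)) * ennreal (exponential_density (l + c) x) \<partial>lborel)"
  proof (intro nn_integral_cong)
    fix x
    have "exponential_density l x * exp (- x * c) = l / (l + c) * exponential_density (l + c) x"
    proof -
      have "exp (- x * l) * exp (- x * c) = exp (- x * (l + c))" by (simp add: exp_add[symmetric] algebra_simps)
      then show ?thesis using assms by (simp add: exponential_density_def)
    qed
    then show "ennreal (exponential_density l x) * ennreal (exp (- x * c)) = ennreal (l / (l + c)) * ennreal (exponential_density (l + c) x)"
      using assms by (simp add: ennreal_mult''[symmetric] ennreal_mult'[symmetric])
  qed
  also have "\<dots> = ennreal (l / (l + c)) * emeasure (density lborel (exponential_density (l + c))) (space (density lborel (exponential_density (l + c))))"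
    by (subst nn_integral_cmult) (auto simp: emeasure_density)
  finally show ?thesis by (simp only: emeasure_space_1 mult_1_right)
qed

subsection \<open>Stopped random walks and hitting times\<close>

lemma (in prob_space) nn_integral_indep_var:
  assumes "indep_var S X T Y" and [measurable]: "f \<in> borel_measurable S" "g \<in> borel_measurable T"
  shows "(\<integral>\<^sup>+\<omega>. f (X \<omega>) * g (Y \<omega>) \<partial>M) = (\<integral>\<^sup>+\<omega>. f (X \<omega>) \<partial>M) * (\<integral>\<^sup>+\<omega>. g (Y \<omega>) \<partial>M)"
proof -
  have [measurable]: "random_variable S X" "random_variable T Y"
    and eq: "distr M S X \<Otimes>\<^sub>M distr M T Y = distr M (S \<Otimes>\<^sub>M T) (\<lambda>x. (X x, Y x))"
    using assms(1) by (auto simp: indep_var_distribution_eq)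
  interpret X: prob_space "distr M S X" by (rule prob_space_distr) fact
  interpret Y: prob_space "distr M T Y" by (rule prob_space_distr) fact
  have "(\<integral>\<^sup>+\<omega>. f (X \<omega>) * g (Y \<omega>) \<partial>M) = (\<integral>\<^sup>+p. f (fst p) * g (snd p) \<partial>(distr M S X \<Otimes>\<^sub>M distr M T Y))"
    unfolding eq by (simp add: nn_integral_distr)
  also have "\<dots> = (\<integral>\<^sup>+x. \<integral>\<^sup>+y. f x * g y \<partial>distr M T Y \<partial>distr M S X)"
    by (subst Y.nn_integral_fst[symmetric]) auto
  also have "\<dots> = (\<integral>\<^sup>+x. f x \<partial>distr M S X) * (\<integral>\<^sup>+y. g y \<partial>distr M T Y)"
    by (simp add: nn_integral_cmult nn_integral_multc)
  finally show ?thesis by (simp add: nn_integral_distr)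
qed

text \<open>The state is the pair of the number of steps made and the position; the walk freezes
  as soon as the state satisfies \<open>q\<close>.\<close>

primrec stopped_walk :: "(real \<times> real \<Rightarrow> bool) \<Rightarrow> nat \<Rightarrow> (nat \<Rightarrow> real) \<Rightarrow> real \<times> real" where
  "stopped_walk q 0 y = (0, 0)"
| "stopped_walk q (Suc n) y =
     (let s = stopped_walk q n y in if q s then s else (fst s + 1, snd s + y n))"

lemma stopped_walk_cong:
  "(\<And>j. j < n \<Longrightarrow> y j = y' j) \<Longrightarrow> stopped_walk q n y = stopped_walk q n y'"
  by (induction n) (auto simp: Let_def)

lemma measurable_stopped_walk:
  assumes [measurable]: "Measurable.pred (borel \<Otimes>\<^sub>M borel) q"
  shows "n \<le> N \<Longrightarrow> stopped_walk q n \<in> (\<Pi>\<^sub>M i\<in>{..<N}. borel) \<rightarrow>\<^sub>M borel \<Otimes>\<^sub>M borel"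
proof (induction n)
  case (Suc n)
  then have [measurable]: "stopped_walk q n \<in> (\<Pi>\<^sub>M i\<in>{..<N}. borel) \<rightarrow>\<^sub>M borel \<Otimes>\<^sub>M borel"
    and [measurable]: "(\<lambda>y. y n) \<in> (\<Pi>\<^sub>M i\<in>{..<N}. borel) \<rightarrow>\<^sub>M borel"
    by (auto intro!: measurable_component_singleton)
  show ?case by (simp add: Let_def)
next
  case 0
  have "stopped_walk q 0 = (\<lambda>_. (0, 0))" by auto
  then show ?case by (simp add: space_pair_measure)
qed

text \<open>The increments telescope, so on the increments of \<open>b\<close> the recursive
  freezing amounts to evaluating \<open>b\<close> at the first index satisfying \<open>q\<close>,
  capped at \<open>n\<close>.\<close>

lemma stopped_walk_increments:
  "\<exists>k\<le>n. stopped_walk q n (\<lambda>j. b (Suc j) - b j) = (real k, b k - b 0)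
     \<and> (k = n \<or> q (real k, b k - b 0)) \<and> (\<forall>j<k. \<not> q (real j, b j - b 0))"
proof (induction n)
  case (Suc n)
  then obtain k where k: "k \<le> n" "stopped_walk q n (\<lambda>j. b (Suc j) - b j) = (real k, b k - b 0)"
    "k = n \<or> q (real k, b k - b 0)" "\<forall>j<k. \<not> q (real j, b j - b 0)" by blast
  show ?case
  proof (cases "q (real k, b k - b 0)")
    case True
    then show ?thesis using k by (intro exI[of _ k]) auto
  next
    case False
    then show ?thesis using k by (intro exI[of _ "Suc n"]) (auto simp: less_Suc_eq)
  qed
qed simp

text \<open>The factor of the increment \<open>\<xi>\<^sub>n\<close> has mean 1 and is independent of the event of still
  running at \<open>n\<close>, which depends on the earlier increments only.\<close>

lemma (in prob_space) nn_integral_stopped_walk: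
  fixes \<xi> :: "nat \<Rightarrow> 'a \<Rightarrow> real"
  assumes indep: "\<And>n. indep_vars (\<lambda>_. borel) \<xi> {..<n}"
    and one: "\<And>k. (\<integral>\<^sup>+\<omega>. ennreal (exp (b * \<xi> k \<omega> - c)) \<partial>M) = 1"
    and q[measurable]: "Measurable.pred (borel \<Otimes>\<^sub>M borel) q"
  defines "W n \<omega> \<equiv> stopped_walk q n (\<lambda>j. \<xi> j \<omega>)"
  shows "W n \<in> M \<rightarrow>\<^sub>M borel \<Otimes>\<^sub>M borel"
    and "(\<integral>\<^sup>+\<omega>. ennreal (exp (b * snd (W n \<omega>) - c * fst (W n \<omega>))) \<partial>M) = 1"
proof -
  have rv[measurable]: "random_variable borel (\<xi> k)" for k
    using indep[of "Suc k"] by (auto simp: indep_vars_def)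
  have W: "W n \<omega> = stopped_walk q n (\<lambda>j\<in>{..<n}. \<xi> j \<omega>)" for n \<omega>
    unfolding W_def by (rule stopped_walk_cong) auto
  have Wm[measurable]: "W n \<in> M \<rightarrow>\<^sub>M borel \<Otimes>\<^sub>M borel" for n
    unfolding W[abs_def]
    by (rule measurable_compose[OF _ measurable_stopped_walk[OF q order_refl]])
       (auto intro!: measurable_restrict)
  show "W n \<in> M \<rightarrow>\<^sub>M borel \<Otimes>\<^sub>M borel" by fact
  define e where "e s = ennreal (exp (b * snd s - c * fst s))" for s :: "real \<times> real"
  have [measurable]: "e \<in> borel_measurable (borel \<Otimes>\<^sub>M borel)"
    unfolding e_def by measurable
  have "(\<integral>\<^sup>+\<omega>. e (W n \<omega>) \<partial>M) = 1"
  proof (induction n)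
    case 0
    show ?case by (simp add: W_def e_def emeasure_space_1)
  next
    case (Suc n)
    \<comment> \<open>\<open>f\<close> is the weight of the still running paths as a function of the
      first \<open>n\<close> increments only. This makes it independent of increment number
      \<open>n\<close>, which is the one added in the next step.\<close>
    define f where "f y = e (stopped_walk q n y) * indicator {s. \<not> q s} (stopped_walk q n y)" for y
    have [measurable]: "stopped_walk q n \<in> (\<Pi>\<^sub>M i\<in>{..<n}. borel) \<rightarrow>\<^sub>M borel \<Otimes>\<^sub>M borel"
      by (rule measurable_stopped_walk) auto
    have fm: "f \<in> borel_measurable (\<Pi>\<^sub>M i\<in>{..<n}. borel)"
      unfolding f_def by measurable
    have "indep_var (PiM {..<n} (\<lambda>_. borel)) (\<lambda>\<omega>. restrict (\<lambda>i. \<xi> i \<omega>) {..<n}) (PiM {n} (\<lambda>_. borel)) (\<lambda>\<omega>. restrict (\<lambda>i. \<xi> i \<omega>) {n})"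
      by (rule indep_var_restrict[OF indep[of "Suc n"]]) auto
    from nn_integral_indep_var[OF this fm, of "\<lambda>y. ennreal (exp (b * y n - c))"]
    have ind: "(\<integral>\<^sup>+\<omega>. f (\<lambda>j\<in>{..<n}. \<xi> j \<omega>) * ennreal (exp (b * \<xi> n \<omega> - c)) \<partial>M) = (\<integral>\<^sup>+\<omega>. f (\<lambda>j\<in>{..<n}. \<xi> j \<omega>) \<partial>M)"
      by (simp add: one)
    have fW: "f (\<lambda>j\<in>{..<n}. \<xi> j \<omega>) = e (W n \<omega>) * indicator {s. \<not> q s} (W n \<omega>)" for \<omega>
      by (simp add: f_def W)
    \<comment> \<open>Frozen paths keep their weight; running paths have it multiplied by the new
      factor of mean 1. Integration therefore leaves the total unchanged.\<close>
    have step: "e (W (Suc n) \<omega>) = e (W n \<omega>) * indicator {s. q s} (W n \<omega>) + f (\<lambda>j\<in>{..<n}. \<xi> j \<omega>) * ennreal (exp (b * \<xi> n \<omega> - c))" for \<omega>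
    proof -
      have "W (Suc n) \<omega> = (if q (W n \<omega>) then W n \<omega> else (fst (W n \<omega>) + 1, snd (W n \<omega>) + \<xi> n \<omega>))"
        by (simp add: W_def Let_def)
      moreover have "e (fst s + 1, snd s + z) = e s * ennreal (exp (b * z - c))" for s z
        by (simp add: e_def ennreal_mult'[symmetric] exp_add[symmetric] algebra_simps)
      ultimately show ?thesis by (simp add: fW)
    qed
    have fWm: "(\<lambda>\<omega>. f (\<lambda>j\<in>{..<n}. \<xi> j \<omega>)) \<in> borel_measurable M"
      unfolding fW by measurable
    have [measurable]: "(\<lambda>\<omega>. ennreal (exp (b * \<xi> n \<omega> - c))) \<in> borel_measurable M"
      by measurable
    have "(\<integral>\<^sup>+\<omega>. e (W (Suc n) \<omega>) \<partial>M) = (\<integral>\<^sup>+\<omega>. e (W n \<omega>) * indicator {s. q s} (W n \<omega>) \<partial>M) + (\<integral>\<^sup>+\<omega>. f (\<lambda>j\<in>{..<n}. \<xi> j \<omega>) \<partial>M)"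
      unfolding step ind[symmetric] by (intro nn_integral_add borel_measurable_times_ennreal) (use fWm in simp_all)
    also have "\<dots> = (\<integral>\<^sup>+\<omega>. e (W n \<omega>) * indicator {s. q s} (W n \<omega>) + e (W n \<omega>) * indicator {s. \<not> q s} (W n \<omega>) \<partial>M)"
      unfolding fW by (intro nn_integral_add[symmetric]) measurable
    also have "\<dots> = (\<integral>\<^sup>+\<omega>. e (W n \<omega>) \<partial>M)"
      by (intro nn_integral_cong) (auto simp: indicator_def)
    finally show ?case using Suc by simp
  qed
  then show "(\<integral>\<^sup>+\<omega>. ennreal (exp (b * snd (W n \<omega>) - c * fst (W n \<omega>))) \<partial>M) = 1"
    by (simp add: e_def)
qed

text \<open>Completing the square shifts the mean from 0 to \<open>2 * b * d\<close>. As the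
  variance is \<open>2 * d\<close>, the compensator is \<open>b\<^sup>2 * d\<close>, without the
  usual factor 1/2.\<close>

lemma nn_integral_exp_normal:
  fixes b d :: real
  assumes d: "0 < d"
  shows "(\<integral>\<^sup>+y. ennreal (normal_density 0 (sqrt (2 * d)) y) * ennreal (exp (b * y - b\<^sup>2 * d)) \<partial>lborel) = 1"
proof -
  interpret prob_space "density lborel (normal_density (2 * b * d) (sqrt (2 * d)))"
    using d by (intro prob_space_normal_density) auto
  have "(\<integral>\<^sup>+y. ennreal (normal_density 0 (sqrt (2 * d)) y) * ennreal (exp (b * y - b\<^sup>2 * d)) \<partial>lborel)
     = (\<integral>\<^sup>+y. ennreal (normal_density (2 * b * d) (sqrt (2 * d)) y) \<partial>lborel)"
  proof (intro nn_integral_cong)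
    fix y :: real
    have "- (y - 2 * b * d)\<^sup>2 / (4 * d) = - y\<^sup>2 / (4 * d) + (b * y - b\<^sup>2 * d)"
      using d by (simp add: field_simps power2_eq_square)
    then have "normal_density (2 * b * d) (sqrt (2 * d)) y = normal_density 0 (sqrt (2 * d)) y * exp (b * y - b\<^sup>2 * d)"
      using d by (simp add: normal_density_def exp_add[symmetric])
    then show "ennreal (normal_density 0 (sqrt (2 * d)) y) * ennreal (exp (b * y - b\<^sup>2 * d)) = ennreal (normal_density (2 * b * d) (sqrt (2 * d)) y)"
      by (simp add: ennreal_mult'')
  qed
  also have "\<dots> = 1" using emeasure_space_1 by (simp add: emeasure_density)
  finally show ?thesis .
qed

section \<open>The first zero of a continuous path\<close>

lemma hitting_time_0_le: "0 \<le> t \<Longrightarrow> x t = 0 \<Longrightarrow> hitting_time_0 x \<le> ereal t"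
  unfolding hitting_time_0_def by (rule INF_lower) auto

lemma hitting_time_0_nonneg: "0 \<le> hitting_time_0 x"
  unfolding hitting_time_0_def by (rule INF_greatest) auto

text \<open>A finite value excludes an empty zero set, whose infimum is \<infinity>, and by
  continuity the zero set is closed, so it contains its infimum.\<close>

lemma hitting_time_0_attained:
  assumes c: "continuous_on {0..} x" and fin: "hitting_time_0 x \<noteq> \<infinity>"
  obtains t where "0 \<le> t" "x t = 0" "hitting_time_0 x = ereal t"
proof -
  define Z where "Z = {t \<in> {0..}. x t = 0}"
  have Z: "closed Z" unfolding Z_def
    by (rule continuous_closed_preimage_constant[OF c]) auto
  have bb: "bdd_below Z" unfolding Z_def by (auto intro!: bdd_belowI[of _ 0])
  have "Z \<noteq> {}" using fin unfolding hitting_time_0_def Z_def by (cases "{t. 0 \<le> t \<and> x t = 0} = {}") (auto simp: top_ereal_def)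
  then have I: "Inf Z \<in> Z" using Z bb by (intro closed_contains_Inf)
  have "hitting_time_0 x = ereal (Inf Z)"
    using I unfolding hitting_time_0_def
    by (intro antisym INF_lower INF_greatest) (auto simp: Z_def intro!: cInf_lower bb[unfolded Z_def])
  with I that show thesis by (auto simp: Z_def)
qed

lemma hitting_time_0_le_of_nonpos:
  assumes c: "continuous_on {0..} x" and x0: "0 \<le> x 0" and t: "0 \<le> t" "x t \<le> 0"
  shows "hitting_time_0 x \<le> ereal t"
proof -
  have "continuous_on {0..t} x" by (rule continuous_on_subset[OF c]) auto
  then obtain s where s: "0 \<le> s" "s \<le> t" "x s = 0"
    using IVT2'[of x t 0 0] x0 t by blast
  then have "hitting_time_0 x \<le> ereal s" by (intro hitting_time_0_le)
  also have "\<dots> \<le> ereal t" using s by simp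
  finally show ?thesis .
qed

text \<open>This describes the event by countably many times, which is what measurability needs. The
  zeros themselves may all be irrational, hence the slack \<open>1 / real (Suc k)\<close> in both
  the time and the value.\<close>

lemma hitting_time_0_le_iff:
  assumes c: "continuous_on {0..} x"
  shows "hitting_time_0 x \<le> ereal t \<longleftrightarrow> (\<forall>k::nat. \<exists>q\<in>\<rat>. 0 \<le> q \<and> q \<le> t + 1 / real (Suc k) \<and> \<bar>x q\<bar> < 1 / real (Suc k))"
    (is "?L \<longleftrightarrow> ?R")
proof
  assume L: ?L
  then have "hitting_time_0 x \<noteq> \<infinity>" by auto
  from hitting_time_0_attained[OF c this] obtain s where s: "0 \<le> s" "x s = 0" "hitting_time_0 x = ereal s" .
  with L have "s \<le> t" by simp
  show ?R
  proof
    fix k :: nat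
    let ?e = "1 / real (Suc k)"
    have "?e > 0" by simp
    with c s obtain d where d: "d > 0" "\<And>q. q \<in> {0..} \<Longrightarrow> dist q s < d \<Longrightarrow> dist (x q) (x s) < ?e"
      unfolding continuous_on_iff by (metis atLeast_iff)
    obtain q where q: "q \<in> \<rat>" "s < q" "q < s + min d ?e"
      using Rats_dense_in_real[of s "s + min d ?e"] d(1) by auto
    have "dist q s < d" using q by (simp add: dist_real_def)
    from d(2)[OF _ this] have "\<bar>x q\<bar> < ?e" using q s by (simp add: dist_real_def)
    then show "\<exists>q\<in>\<rat>. 0 \<le> q \<and> q \<le> t + ?e \<and> \<bar>x q\<bar> < ?e"
      using q s \<open>s \<le> t\<close> by (intro bexI[of _ q]) auto
  qed
next
  assume R: ?R
  then obtain q where q: "\<And>k. 0 \<le> q k" "\<And>k. q k \<le> t + 1 / real (Suc k)" "\<And>k. \<bar>x (q k)\<bar> < 1 / real (Suc k)"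
    by metis
  have "q k \<in> {0..t+1}" for k
  proof -
    have "1 / real (Suc k) \<le> 1" by simp
    with q(1,2)[of k] show ?thesis unfolding atLeastAtMost_iff by linarith
  qed
  \<comment> \<open>A cluster point of these approximate zeros is a true zero, and the vanishing
    slack in time places it no later than \<open>t\<close>.\<close>
  with compact_Icc obtain l r where l: "l \<in> {0..t+1}" "strict_mono r" "(q \<circ> r) \<longlonglongrightarrow> l"
    unfolding compact_def by metis
  have z: "(\<lambda>k. 1 / real (Suc (r k))) \<longlonglongrightarrow> 0"
    using LIMSEQ_subseq_LIMSEQ[OF LIMSEQ_inverse_real_of_nat l(2)] by (simp add: o_def inverse_eq_divide)
  have "l \<le> t + 0"
    by (rule LIMSEQ_le[OF l(3) tendsto_add[OF tendsto_const z]]) (use q(2) in auto)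
  have "(\<lambda>k. x ((q \<circ> r) k)) \<longlonglongrightarrow> x l"
    by (rule continuous_on_tendsto_compose[OF c l(3)]) (use l q in auto)
  moreover have "(\<lambda>k. x ((q \<circ> r) k)) \<longlonglongrightarrow> 0"
    by (rule Lim_null_comparison[OF _ z]) (use q(3) in \<open>auto intro!: always_eventually less_imp_le\<close>)
  ultimately have "x l = 0" by (rule LIMSEQ_unique)
  then have "hitting_time_0 x \<le> ereal l" using l by (intro hitting_time_0_le) auto
  also have "\<dots> \<le> ereal t" using \<open>l \<le> t + 0\<close> by simp
  finally show ?L .
qed

lemma borel_measurable_hitting_time_0:
  assumes [measurable]: "\<And>t. 0 \<le> t \<Longrightarrow> X t \<in> borel_measurable N"
    and c: "\<And>\<omega>. \<omega> \<in> space N \<Longrightarrow> continuous_on {0..} (\<lambda>t. X t \<omega>)"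
  shows "(\<lambda>\<omega>. hitting_time_0 (\<lambda>t. X t \<omega>)) \<in> borel_measurable N"
proof (rule borel_measurable_iff_Iic_ereal[THEN iffD2, rule_format])
  fix t :: ereal
  have *: "{\<omega> \<in> space N. hitting_time_0 (\<lambda>t. X t \<omega>) \<le> ereal r} \<in> sets N" for r
  proof -
    have "{\<omega> \<in> space N. hitting_time_0 (\<lambda>t. X t \<omega>) \<le> ereal r} =
      space N \<inter> (\<Inter>k::nat. \<Union>q\<in>{q\<in>\<rat>. 0 \<le> q \<and> q \<le> r + 1 / real (Suc k)}. {\<omega> \<in> space N. \<bar>X q \<omega>\<bar> < 1 / real (Suc k)})"
      (is "?A = ?B")
    proof (intro set_eqI)
      fix \<omega> show "\<omega> \<in> ?A \<longleftrightarrow> \<omega> \<in> ?B"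
        using hitting_time_0_le_iff[OF c[of \<omega>], of r] by blast
    qed
    also have "\<dots> \<in> sets N"
      by (intro sets.Int sets.top sets.countable_INT image_subsetI sets.countable_UN')
         (auto intro: countable_subset[OF _ countable_rat])
    finally show ?thesis .
  qed
  show "(\<lambda>\<omega>. hitting_time_0 (\<lambda>t. X t \<omega>)) -` {..t} \<inter> space N \<in> sets N"
  proof (cases t)
    case (real r)
    then have "(\<lambda>\<omega>. hitting_time_0 (\<lambda>t. X t \<omega>)) -` {..t} \<inter> space N = {\<omega> \<in> space N. hitting_time_0 (\<lambda>t. X t \<omega>) \<le> ereal r}"
      by auto
    then show ?thesis using *[of r] by simp
  next
    case MInf
    have "\<not> hitting_time_0 (\<lambda>t. X t \<omega>) \<le> - \<infinity>" for \<omega>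
      using hitting_time_0_nonneg[of "\<lambda>t. X t \<omega>"] by auto
    then show ?thesis using MInf by (simp add: vimage_def)
  next
    case PInf
    then show ?thesis by (simp add: vimage_def)
  qed
qed

subsection \<open>Hitting times of drifted Brownian motion\<close>

text \<open>The value 0 at \<infinity> is the limit of \<open>exp (- u * t)\<close> for positive
  \<open>u\<close>, so a transform also sees an atom at \<infinity>, as missing mass.\<close>

definition exp_neg :: "real \<Rightarrow> ereal \<Rightarrow> real" where
  "exp_neg u \<tau> = (if \<tau> = \<infinity> then 0 else exp (- u * real_of_ereal \<tau>))"

lemma exp_neg_simps [simp]: "exp_neg u (ereal t) = exp (- u * t)" "exp_neg u \<infinity> = 0"
  by (auto simp: exp_neg_def)

lemma exp_neg_nonneg [simp]: "0 \<le> exp_neg u \<tau>"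
  by (simp add: exp_neg_def)

lemma borel_measurable_exp_neg [measurable]: "exp_neg u \<in> borel_measurable borel"
  unfolding exp_neg_def by measurable

lemma exp_neg_mono: "0 \<le> u \<Longrightarrow> 0 \<le> s \<Longrightarrow> s \<le> \<tau> \<Longrightarrow> exp_neg u \<tau> \<le> exp_neg u s"
  by (cases s; cases \<tau>) (auto intro: mult_left_mono)

lemma tempered_exponent_nonneg: "0 \<le> u \<Longrightarrow> 0 \<le> tempered_exponent \<theta> u"
  by (simp add: tempered_exponent_def)

context brownian_motion_2
begin

text \<open>On a grid of mesh \<open>S / n\<close> optional stopping is a finite statement about
  independent increments. \<open>\<rho>\<close> is the first grid time at which the path is at most
  \<open>\<delta>\<close>, capped at \<open>S\<close>. The identity is kept for every
  \<open>b\<close>, because the second moment of the stopped martingale requires the doubled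
  parameter.\<close>

lemma discrete_stopping:
  fixes S \<delta> x m :: real and n :: nat
  assumes S: "0 < S" and n: "0 < n"
  defines "X t \<omega> \<equiv> x + (- m) * t + B t \<omega>"
  obtains \<rho> where "\<rho> \<in> borel_measurable M" "(\<lambda>\<omega>. B (\<rho> \<omega>) \<omega>) \<in> borel_measurable M"
    "\<And>\<omega>. \<omega> \<in> space M \<Longrightarrow> \<exists>k\<le>n. \<rho> \<omega> = real k * (S / n) \<and> (k = n \<or> X (\<rho> \<omega>) \<omega> \<le> \<delta>)
        \<and> (\<forall>j<k. \<delta> < X (real j * (S / n)) \<omega>)"
    "\<And>b. (\<integral>\<^sup>+\<omega>. ennreal (exp (b * B (\<rho> \<omega>) \<omega> - b\<^sup>2 * \<rho> \<omega>)) \<partial>M) = 1"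
proof -
  define d where "d = S / n"
  have d: "0 < d" using S n by (simp add: d_def)
  define \<xi> where "\<xi> k \<omega> = B (real (Suc k) * d) \<omega> - B (real k * d) \<omega>" for k \<omega>
  define q where "q s \<longleftrightarrow> x + (- m) * (fst s * d) + snd s \<le> \<delta>" for s :: "real \<times> real"
  have q[measurable]: "Measurable.pred (borel \<Otimes>\<^sub>M borel) q"
    unfolding q_def by measurable
  have indep: "indep_vars (\<lambda>_. borel) \<xi> {..<k}" for k
    using indep_increments[unfolded independent_increments_def, rule_format, of "\<lambda>k. real k * d" k] d
    unfolding \<xi>_def by (auto simp: mono_def intro!: mult_right_mono)
  have one: "(\<integral>\<^sup>+\<omega>. ennreal (exp (b * \<xi> k \<omega> - b\<^sup>2 * d)) \<partial>M) = 1" for b k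
  proof -
    have "distributed M lborel (\<xi> k) (normal_density 0 (sqrt (2 * (real (Suc k) * d - real k * d))))"
      unfolding \<xi>_def using d by (intro normal_increments) auto
    then have "distributed M lborel (\<xi> k) (normal_density 0 (sqrt (2 * d)))"
      by (simp add: algebra_simps)
    from distributed_nn_integral[OF this, of "\<lambda>y. ennreal (exp (b * y - b\<^sup>2 * d))"] show ?thesis
      using nn_integral_exp_normal[OF d, of b] by simp
  qed
  define W where "W \<omega> = stopped_walk q n (\<lambda>j. \<xi> j \<omega>)" for \<omega>
  have [measurable]: "W \<in> M \<rightarrow>\<^sub>M borel \<Otimes>\<^sub>M borel"
    unfolding W_def by (rule nn_integral_stopped_walk(1)[OF indep one q])
  have W: "\<exists>k\<le>n. W \<omega> = (real k, B (real k * d) \<omega>) \<and> (k = n \<or> X (real k * d) \<omega> \<le> \<delta>)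
      \<and> (\<forall>j<k. \<delta> < X (real j * d) \<omega>)" if "\<omega> \<in> space M" for \<omega>
    using stopped_walk_increments[of n q "\<lambda>k. B (real k * d) \<omega>"] start_0[OF that]
    unfolding W_def \<xi>_def q_def X_def by (auto simp: not_le)
  define \<rho> where "\<rho> \<omega> = fst (W \<omega>) * d" for \<omega>
  \<comment> \<open>The walk carries the position along, so \<open>B\<close> at the random time
    \<open>\<rho>\<close> is measurable as a coordinate of \<open>W\<close>.\<close>
  have BW: "B (\<rho> \<omega>) \<omega> = snd (W \<omega>)" if "\<omega> \<in> space M" for \<omega>
    using W[OF that] by (auto simp: \<rho>_def)
  show thesis
  proof
    show "\<rho> \<in> borel_measurable M" unfolding \<rho>_def by measurable
    show "(\<lambda>\<omega>. B (\<rho> \<omega>) \<omega>) \<in> borel_measurable M"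
      by (subst measurable_cong[OF BW]) (assumption, measurable)
    show "\<exists>k\<le>n. \<rho> \<omega> = real k * (S / n) \<and> (k = n \<or> X (\<rho> \<omega>) \<omega> \<le> \<delta>)
        \<and> (\<forall>j<k. \<delta> < X (real j * (S / n)) \<omega>)" if "\<omega> \<in> space M" for \<omega>
      using W[OF that] unfolding \<rho>_def d_def[symmetric] by (metis fst_conv)
    show "(\<integral>\<^sup>+\<omega>. ennreal (exp (b * B (\<rho> \<omega>) \<omega> - b\<^sup>2 * \<rho> \<omega>)) \<partial>M) = 1" for b
    proof -
      have "(\<integral>\<^sup>+\<omega>. ennreal (exp (b * B (\<rho> \<omega>) \<omega> - b\<^sup>2 * \<rho> \<omega>)) \<partial>M)
        = (\<integral>\<^sup>+\<omega>. ennreal (exp (b * snd (W \<omega>) - b\<^sup>2 * d * fst (W \<omega>))) \<partial>M)"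
        by (intro nn_integral_cong) (simp add: BW, simp add: \<rho>_def mult_ac)
      also have "\<dots> = 1"
        unfolding W_def by (rule nn_integral_stopped_walk(2)[OF indep one q])
      finally show ?thesis .
    qed
  qed
qed

context
  fixes x m u :: real
  assumes m: "0 < m" and u: "0 < u"
begin

definition "drifted t \<omega> = x + (- m) * t + B t \<omega>"

abbreviation "\<tau> \<omega> \<equiv> hitting_time_0 (\<lambda>t. drifted t \<omega>)"
abbreviation "\<Phi> \<equiv> tempered_exponent ((m / 2)\<^sup>2) u"

lemma continuous_drifted: "\<omega> \<in> space M \<Longrightarrow> continuous_on {0..} (\<lambda>t. drifted t \<omega>)"
  unfolding drifted_def by (intro continuous_intros continuous_paths)

lemma measurable_hitting [measurable]: "\<tau> \<in> borel_measurable M"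
  by (rule borel_measurable_hitting_time_0[OF _ continuous_drifted])
     (auto simp: drifted_def intro!: borel_measurable_add measurable_at)

text \<open>The quadratic equation is the matching condition for the martingale: the compensator
  \<open>\<Phi>\<^sup>2 * t\<close> and the drift contribution \<open>m * \<Phi> * t\<close> add up
  to the discount exponent \<open>u * t\<close>.\<close>

lemma exponent_pos: "0 \<le> \<Phi>" and exponent_sq: "\<Phi>\<^sup>2 + m * \<Phi> = u"
proof -
  have *: "\<Phi> = sqrt (u + (m/2)\<^sup>2) - m / 2" using m by (simp add: tempered_exponent_def)
  show "0 \<le> \<Phi>" using u by (intro tempered_exponent_nonneg) simp
  have "(\<Phi> + m / 2)\<^sup>2 = u + (m/2)\<^sup>2" unfolding * using u by simp
  then show "\<Phi>\<^sup>2 + m * \<Phi> = u" by (simp add: power2_eq_square field_simps)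
qed

lemma exponential_martingale_eq:
  "exp (- \<Phi> * B t \<omega> - (- \<Phi>)\<^sup>2 * t) = exp (x * \<Phi>) * exp (- \<Phi> * drifted t \<omega>) * exp (- u * t)"
proof -
  have "u * t = \<Phi>\<^sup>2 * t + m * \<Phi> * t" 
    using arg_cong[OF exponent_sq, of "\<lambda>v. v * t"] by (simp add: distrib_right)
  then show ?thesis by (simp add: exp_add[symmetric] drifted_def algebra_simps)
qed

lemma stopping_sequence:
  assumes S: "0 < S"
  obtains \<rho> where "\<And>n. \<rho> n \<in> borel_measurable M" "\<And>n. (\<lambda>\<omega>. B (\<rho> n \<omega>) \<omega>) \<in> borel_measurable M"
    "\<And>n \<omega>. \<omega> \<in> space M \<Longrightarrow> \<exists>k\<le>Suc n. \<rho> n \<omega> = real k * (S / Suc n) \<and> (k = Suc n \<or> drifted (\<rho> n \<omega>) \<omega> \<le> \<delta>)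
        \<and> (\<forall>j<k. \<delta> < drifted (real j * (S / Suc n)) \<omega>)"
    "\<And>n b. (\<integral>\<^sup>+\<omega>. ennreal (exp (b * B (\<rho> n \<omega>) \<omega> - b\<^sup>2 * \<rho> n \<omega>)) \<partial>M) = 1"
proof -
  define P where "P n \<rho> \<longleftrightarrow> \<rho> \<in> borel_measurable M \<and> (\<lambda>\<omega>. B (\<rho> \<omega>) \<omega>) \<in> borel_measurable M \<and>
     (\<forall>\<omega>\<in>space M. \<exists>k\<le>Suc n. \<rho> \<omega> = real k * (S / Suc n) \<and> (k = Suc n \<or> drifted (\<rho> \<omega>) \<omega> \<le> \<delta>)
        \<and> (\<forall>j<k. \<delta> < drifted (real j * (S / Suc n)) \<omega>)) \<and>
     (\<forall>b. (\<integral>\<^sup>+\<omega>. ennreal (exp (b * B (\<rho> \<omega>) \<omega> - b\<^sup>2 * \<rho> \<omega>)) \<partial>M) = 1)" for n \<rho>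
  have "\<exists>\<rho>. P n \<rho>" for n
    unfolding P_def
    by (rule discrete_stopping[OF S zero_less_Suc, of n x m \<delta>, folded drifted_def]) blast
  then have "P n (SOME \<rho>. P n \<rho>)" for n
    by (rule someI_ex)
  then show thesis
    unfolding P_def by (intro that[of "\<lambda>n. SOME \<rho>. P n \<rho>", unfolded P_def]) blast+
qed

text \<open>Stopping at a level \<open>\<delta> > 0\<close> guarantees that a grid point near \<open>\<tau>\<close> triggers the stopping
  rule, even if the path only touches 0 at \<open>\<tau>\<close>; Fatou's lemma then needs no domination.\<close>

lemma laplace_hitting_upper:
  assumes x: "0 < x" and \<delta>: "0 < \<delta>" and S: "0 < S"
  shows "(\<integral>\<^sup>+\<omega>. ennreal (exp_neg u (\<tau> \<omega>)) \<partial>M) \<le> ennreal (exp (- (x - \<delta>) * \<Phi>) + exp (- u * S))"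
proof -
  obtain \<rho> where [measurable]: "\<And>n. \<rho> n \<in> borel_measurable M" "\<And>n. (\<lambda>\<omega>. B (\<rho> n \<omega>) \<omega>) \<in> borel_measurable M"
    and \<rho>: "\<And>n \<omega>. \<omega> \<in> space M \<Longrightarrow> \<exists>k\<le>Suc n. \<rho> n \<omega> = real k * (S / Suc n) \<and> (k = Suc n \<or> drifted (\<rho> n \<omega>) \<omega> \<le> \<delta>)
        \<and> (\<forall>j<k. \<delta> < drifted (real j * (S / Suc n)) \<omega>)"
    and one: "\<And>n b. (\<integral>\<^sup>+\<omega>. ennreal (exp (b * B (\<rho> n \<omega>) \<omega> - b\<^sup>2 * \<rho> n \<omega>)) \<partial>M) = 1"
    using stopping_sequence[OF S, of \<delta>] by blast
  have [measurable]: "(\<lambda>\<omega>. drifted (\<rho> n \<omega>) \<omega>) \<in> borel_measurable M" for n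
    unfolding drifted_def by measurable
  \<comment> \<open>\<open>f\<close> is the discount of the paths that really got down to
    \<open>\<delta>\<close>. In \<open>g\<close> the factor \<open>exp (u * (S / Suc n))\<close>
    pays for stopping up to one mesh step after the hitting time, and \<open>exp (- u * S)\<close>
    covers the paths not hitting before \<open>S\<close>.\<close>
  define f where "f n \<omega> = exp (- u * \<rho> n \<omega>) * indicator {y. y \<le> \<delta>} (drifted (\<rho> n \<omega>) \<omega>)" for n \<omega>
  define g where "g n \<omega> = exp (u * (S / Suc n)) * f n \<omega> + exp (- u * S)" for n \<omega>
  have f0: "0 \<le> f n \<omega>" for n \<omega> by (simp add: f_def)
  have [measurable]: "f n \<in> borel_measurable M" for n
    unfolding f_def by measurable
  have [measurable]: "g n \<in> borel_measurable M" for n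
    unfolding g_def by measurable
  have f: "(\<integral>\<^sup>+\<omega>. ennreal (f n \<omega>) \<partial>M) \<le> ennreal (exp (- (x - \<delta>) * \<Phi>))" for n
  proof -
    have "(\<integral>\<^sup>+\<omega>. ennreal (f n \<omega>) \<partial>M) \<le> (\<integral>\<^sup>+\<omega>. ennreal (exp (- (x - \<delta>) * \<Phi>)) * ennreal (exp (- \<Phi> * B (\<rho> n \<omega>) \<omega> - (- \<Phi>)\<^sup>2 * \<rho> n \<omega>)) \<partial>M)"
    proof (intro nn_integral_mono)
      fix \<omega>
      \<comment> \<open>At a position of at most \<open>\<delta>\<close> the factor
        \<open>exp (- \<Phi> * y)\<close> is at least \<open>exp (- \<Phi> * \<delta>)\<close>, so
        the martingale dominates the discount up to a constant.\<close>
      have "exp (- u * t) \<le> exp (- (x - \<delta>) * \<Phi>) * (exp (x * \<Phi>) * exp (- \<Phi> * y) * exp (- u * t))" if "y \<le> \<delta>" for y t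
      proof -
        have "\<Phi> * y \<le> \<Phi> * \<delta>" using that exponent_pos by (rule mult_left_mono)
        then show ?thesis by (simp add: exp_add[symmetric] algebra_simps)
      qed
      then have "f n \<omega> \<le> exp (- (x - \<delta>) * \<Phi>) * exp (- \<Phi> * B (\<rho> n \<omega>) \<omega> - (- \<Phi>)\<^sup>2 * \<rho> n \<omega>)"
        unfolding exponential_martingale_eq f_def by (auto simp: indicator_def)
      then show "ennreal (f n \<omega>) \<le> ennreal (exp (- (x - \<delta>) * \<Phi>)) * ennreal (exp (- \<Phi> * B (\<rho> n \<omega>) \<omega> - (- \<Phi>)\<^sup>2 * \<rho> n \<omega>))"
        by (simp add: ennreal_mult'[symmetric] ennreal_leI)
    qed
    also have "\<dots> = ennreal (exp (- (x - \<delta>) * \<Phi>)) * 1"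
      unfolding one[symmetric, of "- \<Phi>" n] by (rule nn_integral_cmult) measurable
    finally show ?thesis by simp
  qed
  have g: "(\<integral>\<^sup>+\<omega>. ennreal (g n \<omega>) \<partial>M) \<le> ennreal (exp (u * (S / Suc n)) * exp (- (x - \<delta>) * \<Phi>) + exp (- u * S))" for n
  proof -
    have "(\<integral>\<^sup>+\<omega>. ennreal (g n \<omega>) \<partial>M) = (\<integral>\<^sup>+\<omega>. ennreal (exp (u * (S / Suc n))) * ennreal (f n \<omega>) + ennreal (exp (- u * S)) \<partial>M)"
      unfolding g_def by (intro nn_integral_cong) (simp add: f0 ennreal_plus[symmetric] ennreal_mult'[symmetric] del: ennreal_plus)
    also have "\<dots> = ennreal (exp (u * (S / Suc n))) * (\<integral>\<^sup>+\<omega>. ennreal (f n \<omega>) \<partial>M) + ennreal (exp (- u * S))"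
      by (simp add: nn_integral_add nn_integral_cmult emeasure_space_1)
    also have "\<dots> \<le> ennreal (exp (u * (S / Suc n))) * ennreal (exp (- (x - \<delta>) * \<Phi>)) + ennreal (exp (- u * S))"
      by (intro add_mono mult_left_mono f) auto
    also have "\<dots> = ennreal (exp (u * (S / Suc n)) * exp (- (x - \<delta>) * \<Phi>) + exp (- u * S))"
      by (simp only: ennreal_plus[OF mult_nonneg_nonneg[OF exp_ge_zero exp_ge_zero] exp_ge_zero] ennreal_mult'[OF exp_ge_zero])
    finally show ?thesis .
  qed
  have point: "\<forall>\<^sub>F n in sequentially. exp_neg u (\<tau> \<omega>) \<le> g n \<omega>" if \<omega>: "\<omega> \<in> space M" for \<omega>
  proof (cases "\<tau> \<omega> < ereal S")
    case False
    then have "exp_neg u (\<tau> \<omega>) \<le> exp_neg u (ereal S)"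
      using u S by (intro exp_neg_mono) auto
    then have "exp_neg u (\<tau> \<omega>) \<le> g n \<omega>" for n
      unfolding g_def using mult_nonneg_nonneg[OF exp_ge_zero f0, of "u * (S / Suc n)" n \<omega>] by simp
    then show ?thesis by simp
  next
    case True
    then have "\<tau> \<omega> \<noteq> \<infinity>" by auto
    from hitting_time_0_attained[OF continuous_drifted[OF \<omega>] this]
    obtain t where t: "0 \<le> t" "drifted t \<omega> = 0" "\<tau> \<omega> = ereal t" .
    have "t < S" using True t by simp
    obtain e where e: "0 < e" "\<And>s. s \<in> {0..} \<Longrightarrow> dist s t < e \<Longrightarrow> dist (drifted s \<omega>) (drifted t \<omega>) < \<delta>"
      using continuous_drifted[OF \<omega>] t \<delta> unfolding continuous_on_iff by (metis atLeast_iff)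
    have "(\<lambda>n. S / real (Suc n)) \<longlonglongrightarrow> 0"
      using tendsto_mult[OF tendsto_const LIMSEQ_inverse_real_of_nat, of S] by (simp add: divide_inverse)
    then have "\<forall>\<^sub>F n in sequentially. S / real (Suc n) < min e (S - t)"
      using e(1) \<open>t < S\<close> by (intro order_tendstoD) auto
    then show ?thesis
    proof eventually_elim
      case (elim n)
      define d where "d = S / real (Suc n)"
      have d: "0 < d" "d < e" "d < S - t" "real (Suc n) * d = S" using S elim by (auto simp: d_def)
      \<comment> \<open>This is the first grid index at or after the hitting time \<open>t\<close>.
        As \<open>t + d < S\<close>, it lies strictly below the cap, so the rule has fired by index
        \<open>k\<close> for the right reason and not because time ran out.\<close>
      define k where "k = nat \<lceil>t / d\<rceil>"
      have k: "t \<le> real k * d" "real k * d < t + d"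
      proof -
        have "0 \<le> t / d" using t d by simp
        then have "real k = of_int \<lceil>t / d\<rceil>" by (simp add: k_def)
        then have "t / d \<le> real k" "real k < t / d + 1" by linarith+
        then show "t \<le> real k * d" "real k * d < t + d" using d by (auto simp: field_simps)
      qed
      have "real k * d < real (Suc n) * d" using k d by linarith
      then have kn: "k < Suc n" using d(1) by (metis mult_less_cancel_right_pos of_nat_less_iff)
      have "dist (real k * d) t < e" using k d by (auto simp: dist_real_def)
      from e(2)[OF _ this] have "drifted (real k * d) \<omega> < \<delta>"
        using t k by (auto simp: dist_real_def)
      then obtain j where j: "\<rho> n \<omega> = real j * d" "j \<le> k" "drifted (\<rho> n \<omega>) \<omega> \<le> \<delta>"
        using \<rho>[OF \<omega>, of n] kn unfolding d_def[symmetric] by (metis leI less_asym less_irrefl_nat)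
      have "real j * d \<le> real k * d" using j d by (intro mult_right_mono) auto
      then have "real j * d \<le> t + d" using k by linarith
      then have "u * (real j * d) \<le> u * (t + d)" using u by (intro mult_left_mono) auto
      then have "exp (- u * t) \<le> exp (u * d) * exp (- u * (real j * d))"
        by (simp add: exp_add[symmetric] algebra_simps)
      then show ?case
        unfolding g_def f_def d_def[symmetric] using j t by (simp add: add_increasing2)
    qed
  qed
  have "(\<integral>\<^sup>+\<omega>. ennreal (exp_neg u (\<tau> \<omega>)) \<partial>M) \<le> (\<integral>\<^sup>+\<omega>. liminf (\<lambda>n. ennreal (g n \<omega>)) \<partial>M)"
  proof (intro nn_integral_mono Liminf_bounded)
    fix \<omega> assume "\<omega> \<in> space M"
    from point[OF this] show "\<forall>\<^sub>F n in sequentially. ennreal (exp_neg u (\<tau> \<omega>)) \<le> ennreal (g n \<omega>)"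
      by eventually_elim (rule ennreal_leI)
  qed
  also have "\<dots> \<le> liminf (\<lambda>n. \<integral>\<^sup>+\<omega>. ennreal (g n \<omega>) \<partial>M)"
    by (rule nn_integral_liminf) measurable
  also have "\<dots> \<le> liminf (\<lambda>n. ennreal (exp (u * (S / Suc n)) * exp (- (x - \<delta>) * \<Phi>) + exp (- u * S)))"
    by (intro Liminf_mono always_eventually allI g)
  also have "\<dots> = ennreal (exp (u * 0) * exp (- (x - \<delta>) * \<Phi>) + exp (- u * S))"
  proof (rule lim_imp_Liminf)
    have "(\<lambda>n. S / real (Suc n)) \<longlonglongrightarrow> 0"
      using tendsto_mult[OF tendsto_const LIMSEQ_inverse_real_of_nat, of S] by (simp add: divide_inverse)
    then show "(\<lambda>n. ennreal (exp (u * (S / Suc n)) * exp (- (x - \<delta>) * \<Phi>) + exp (- u * S))) \<longlonglongrightarrow> ennreal (exp (u * 0) * exp (- (x - \<delta>) * \<Phi>) + exp (- u * S))"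
      by (intro tendsto_ennrealI tendsto_add tendsto_mult tendsto_exp tendsto_const)
  qed simp
  finally show ?thesis by simp
qed

text \<open>One grid step before stopping the path is still positive, so the overshoot is at most
  the oscillation over one mesh step, which uniform continuity on \<open>{0..S}\<close> makes small.
  Stopping at index 0 gives no overshoot, because the start \<open>x\<close> is nonnegative.\<close>

lemma overshoot_tendsto_0:
  assumes x: "0 \<le> x" and S: "0 < S" and \<omega>: "\<omega> \<in> space M"
    and \<rho>: "\<And>n. \<exists>k\<le>Suc n. r n = real k * (S / Suc n) \<and> (\<forall>j<k. 0 < drifted (real j * (S / Suc n)) \<omega>)"
  shows "(\<lambda>n. max 0 (- drifted (r n) \<omega>)) \<longlonglongrightarrow> 0"
proof (rule LIMSEQ_I)
  fix e :: real assume e: "0 < e"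
  have "uniformly_continuous_on {0..S} (\<lambda>t. drifted t \<omega>)"
    by (intro compact_uniformly_continuous continuous_on_subset[OF continuous_drifted[OF \<omega>]]) auto
  then obtain \<eta> where \<eta>: "0 < \<eta>" "\<And>s t. s \<in> {0..S} \<Longrightarrow> t \<in> {0..S} \<Longrightarrow> dist t s < \<eta> \<Longrightarrow> dist (drifted t \<omega>) (drifted s \<omega>) < e"
    unfolding uniformly_continuous_on_def using e by metis
  have "(\<lambda>n. S / real (Suc n)) \<longlonglongrightarrow> 0"
    using tendsto_mult[OF tendsto_const LIMSEQ_inverse_real_of_nat, of S] by (simp add: divide_inverse)
  then have "\<forall>\<^sub>F n in sequentially. S / real (Suc n) < \<eta>"
    using \<eta>(1) by (rule order_tendstoD)
  then obtain n0 where n0: "\<And>n. n \<ge> n0 \<Longrightarrow> S / real (Suc n) < \<eta>"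
    unfolding eventually_sequentially by blast
  have "norm (max 0 (- drifted (r n) \<omega>) - 0) < e" if "n \<ge> n0" for n
  proof -
    define d where "d = S / real (Suc n)"
    have d: "0 < d" "real (Suc n) * d = S" "d < \<eta>" using S n0[OF that] by (auto simp: d_def)
    obtain k where k: "k \<le> Suc n" "r n = real k * d" "\<And>j. j < k \<Longrightarrow> 0 < drifted (real j * d) \<omega>"
      using \<rho>[of n] unfolding d_def by blast
    have "- drifted (r n) \<omega> < e"
    proof (cases k)
      case 0
      then show ?thesis using k x e start_0[OF \<omega>] by (simp add: drifted_def)
    next
      case (Suc j)
      have "real k * d \<le> real (Suc n) * d" using k d by (intro mult_right_mono) auto
      then have "real k * d \<in> {0..S}" using d by auto
      moreover have "real j * d \<le> real k * d" using Suc d by (intro mult_right_mono) auto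
      with calculation d have "real j * d \<in> {0..S}" by auto
      moreover have "dist (real k * d) (real j * d) < \<eta>"
        using d Suc by (simp add: dist_real_def algebra_simps)
      ultimately have "dist (drifted (real k * d) \<omega>) (drifted (real j * d) \<omega>) < e"
        by (intro \<eta>(2))
      then show ?thesis using k(2) k(3)[of j] Suc by (auto simp: dist_real_def)
    qed
    then show ?thesis using e by auto
  qed
  then show "\<exists>n0. \<forall>n\<ge>n0. norm (max 0 (- drifted (r n) \<omega>) - 0) < e" by blast
qed

text \<open>The overshoot below 0 makes the stopped martingale \<open>Z\<close> unbounded. It is split by
  \<open>Z \<le> min K Z + Z\<^sup>2 / K\<close>, where the second moment is controlled by the exponential martingale
  with doubled parameter.\<close>

lemma laplace_hitting_lower_truncated:
  assumes x: "0 \<le> x" and S: "0 < S" and K: "0 < K"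
  shows "1 \<le> (\<integral>\<omega>. exp (x * \<Phi>) * (exp_neg u (\<tau> \<omega>) + exp (- u * S)) \<partial>M) + exp (2 * \<Phi>\<^sup>2 * S) / K"
proof -
  obtain \<rho> where [measurable]: "\<And>n. \<rho> n \<in> borel_measurable M" "\<And>n. (\<lambda>\<omega>. B (\<rho> n \<omega>) \<omega>) \<in> borel_measurable M"
    and \<rho>: "\<And>n \<omega>. \<omega> \<in> space M \<Longrightarrow> \<exists>k\<le>Suc n. \<rho> n \<omega> = real k * (S / Suc n) \<and> (k = Suc n \<or> drifted (\<rho> n \<omega>) \<omega> \<le> 0)
        \<and> (\<forall>j<k. 0 < drifted (real j * (S / Suc n)) \<omega>)"
    and one: "\<And>n b. (\<integral>\<^sup>+\<omega>. ennreal (exp (b * B (\<rho> n \<omega>) \<omega> - b\<^sup>2 * \<rho> n \<omega>)) \<partial>M) = 1"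
    using stopping_sequence[OF S, of 0] by blast
  have [measurable]: "(\<lambda>\<omega>. drifted (\<rho> n \<omega>) \<omega>) \<in> borel_measurable M" for n
    unfolding drifted_def by measurable
  define Z where "Z n \<omega> = exp (- \<Phi> * B (\<rho> n \<omega>) \<omega> - (- \<Phi>)\<^sup>2 * \<rho> n \<omega>)" for n \<omega>
  define ov where "ov n \<omega> = max 0 (- drifted (\<rho> n \<omega>) \<omega>)" for n \<omega>
  define G where "G \<omega> = exp (x * \<Phi>) * (exp_neg u (\<tau> \<omega>) + exp (- u * S))" for \<omega>
  \<comment> \<open>\<open>Z\<close> itself is replaced by its bound in terms of the overshoot and
    of \<open>G\<close>, which does not depend on \<open>n\<close>. The cut at \<open>K\<close>
    supplies the dominating constant for the limit in \<open>n\<close>.\<close>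
  define g where "g n \<omega> = min K (exp (\<Phi> * ov n \<omega>) * G \<omega>)" for n \<omega>
  have [measurable]: "Z n \<in> borel_measurable M" "ov n \<in> borel_measurable M" "G \<in> borel_measurable M" for n
    unfolding Z_def ov_def G_def by measurable
  have [measurable]: "g n \<in> borel_measurable M" for n
    unfolding g_def by measurable
  have G0: "0 \<le> G \<omega>" for \<omega> by (simp add: G_def)
  have g0: "0 \<le> g n \<omega>" "g n \<omega> \<le> K" for n \<omega> using K G0 by (auto simp: g_def)
  have rS: "\<rho> n \<omega> \<le> S" "0 \<le> \<rho> n \<omega>" if \<omega>: "\<omega> \<in> space M" for n \<omega>
  proof -
    obtain k where k: "k \<le> Suc n" "\<rho> n \<omega> = real k * (S / Suc n)" using \<rho>[OF \<omega>] by blast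
    have "real k * (S / Suc n) \<le> real (Suc n) * (S / Suc n)"
      using k(1) S by (intro mult_right_mono) auto
    then show "\<rho> n \<omega> \<le> S" "0 \<le> \<rho> n \<omega>" using k(2) S by auto
  qed
  have ZG: "Z n \<omega> \<le> exp (\<Phi> * ov n \<omega>) * G \<omega>" if \<omega>: "\<omega> \<in> space M" for n \<omega>
  proof -
    have "- \<Phi> * drifted (\<rho> n \<omega>) \<omega> \<le> \<Phi> * ov n \<omega>"
      using mult_left_mono[OF _ exponent_pos, of "- drifted (\<rho> n \<omega>) \<omega>" "ov n \<omega>"] by (simp add: ov_def)
    then have 1: "exp (- \<Phi> * drifted (\<rho> n \<omega>) \<omega>) \<le> exp (\<Phi> * ov n \<omega>)" by simp
    \<comment> \<open>Either the path is at most 0 at \<open>\<rho>\<close>, and then it has crossed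
      0 by that time, or \<open>\<rho>\<close> is the cap \<open>S\<close>.\<close>
    have 2: "exp (- u * \<rho> n \<omega>) \<le> exp_neg u (\<tau> \<omega>) + exp (- u * S)"
    proof (cases "drifted (\<rho> n \<omega>) \<omega> \<le> 0")
      case True
      have "\<tau> \<omega> \<le> ereal (\<rho> n \<omega>)"
        using True rS(2)[OF \<omega>] x start_0[OF \<omega>]
        by (intro hitting_time_0_le_of_nonpos continuous_drifted[OF \<omega>]) (auto simp: drifted_def)
      then have "exp_neg u (ereal (\<rho> n \<omega>)) \<le> exp_neg u (\<tau> \<omega>)"
        using u by (intro exp_neg_mono hitting_time_0_nonneg) auto
      then show ?thesis by (simp add: add_increasing2)
    next
      case False
      then obtain "\<rho> n \<omega> = real (Suc n) * (S / Suc n)" using \<rho>[OF \<omega>, of n] by blast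
      then have "\<rho> n \<omega> = S" by simp
      then show ?thesis by simp
    qed
    have "Z n \<omega> = exp (x * \<Phi>) * (exp (- \<Phi> * drifted (\<rho> n \<omega>) \<omega>) * exp (- u * \<rho> n \<omega>))"
      unfolding Z_def exponential_martingale_eq by (rule mult.assoc)
    also have "\<dots> \<le> exp (x * \<Phi>) * (exp (\<Phi> * ov n \<omega>) * (exp_neg u (\<tau> \<omega>) + exp (- u * S)))"
      by (intro mult_left_mono mult_mono 1 2) auto
    finally show ?thesis by (simp add: G_def mult_ac)
  qed
  \<comment> \<open>Squaring doubles the parameter but yields the compensator
    \<open>2 * \<Phi>\<^sup>2 * \<rho>\<close> where the martingale with parameter
    \<open>- (2 * \<Phi>)\<close> needs \<open>4 * \<Phi>\<^sup>2 * \<rho>\<close>. The difference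
    is at most \<open>2 * \<Phi>\<^sup>2 * S\<close>.\<close>
  have sq: "(\<integral>\<^sup>+\<omega>. ennreal ((Z n \<omega>)\<^sup>2) \<partial>M) \<le> ennreal (exp (2 * \<Phi>\<^sup>2 * S))" for n
  proof -
    have "(\<integral>\<^sup>+\<omega>. ennreal ((Z n \<omega>)\<^sup>2) \<partial>M) \<le> (\<integral>\<^sup>+\<omega>. ennreal (exp (2 * \<Phi>\<^sup>2 * S)) * ennreal (exp (- (2 * \<Phi>) * B (\<rho> n \<omega>) \<omega> - (- (2 * \<Phi>))\<^sup>2 * \<rho> n \<omega>)) \<partial>M)"
    proof (intro nn_integral_mono)
      fix \<omega> assume \<omega>: "\<omega> \<in> space M"
      have "\<Phi>\<^sup>2 * \<rho> n \<omega> \<le> \<Phi>\<^sup>2 * S" using rS[OF \<omega>] by (intro mult_left_mono) auto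
      then have "(Z n \<omega>)\<^sup>2 \<le> exp (2 * \<Phi>\<^sup>2 * S) * exp (- (2 * \<Phi>) * B (\<rho> n \<omega>) \<omega> - (- (2 * \<Phi>))\<^sup>2 * \<rho> n \<omega>)"
        unfolding Z_def by (simp add: exp_double[symmetric] exp_add[symmetric] power_mult_distrib mult.commute)
      then show "ennreal ((Z n \<omega>)\<^sup>2) \<le> ennreal (exp (2 * \<Phi>\<^sup>2 * S)) * ennreal (exp (- (2 * \<Phi>) * B (\<rho> n \<omega>) \<omega> - (- (2 * \<Phi>))\<^sup>2 * \<rho> n \<omega>))"
        by (simp add: ennreal_mult'[symmetric] ennreal_leI)
    qed
    also have "\<dots> = ennreal (exp (2 * \<Phi>\<^sup>2 * S)) * 1"
      unfolding one[symmetric, of "- (2 * \<Phi>)" n] by (rule nn_integral_cmult) measurable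
    finally show ?thesis by simp
  qed
  have bound: "1 \<le> ennreal (\<integral>\<omega>. g n \<omega> \<partial>M) + ennreal (exp (2 * \<Phi>\<^sup>2 * S) / K)" for n
  proof -
    have "1 = (\<integral>\<^sup>+\<omega>. ennreal (Z n \<omega>) \<partial>M)" unfolding Z_def one ..
    also have "\<dots> \<le> (\<integral>\<^sup>+\<omega>. ennreal (g n \<omega>) + ennreal (1 / K) * ennreal ((Z n \<omega>)\<^sup>2) \<partial>M)"
    proof (intro nn_integral_mono)
      fix \<omega> assume \<omega>: "\<omega> \<in> space M"
      have Z0: "0 \<le> Z n \<omega>" by (simp add: Z_def)
      have "Z n \<omega> \<le> g n \<omega> + 1 / K * (Z n \<omega>)\<^sup>2"
      proof (cases "Z n \<omega> \<le> K")
        case True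
        then have "Z n \<omega> \<le> g n \<omega>" using ZG[OF \<omega>] by (simp add: g_def)
        then show ?thesis using K by (simp add: add_increasing2)
      next
        case False
        then have "K * Z n \<omega> \<le> Z n \<omega> * Z n \<omega>" using Z0 by (intro mult_right_mono) auto
        then have "Z n \<omega> \<le> 1 / K * (Z n \<omega>)\<^sup>2" using K by (simp add: field_simps power2_eq_square)
        then show ?thesis using g0 by (simp add: add_increasing)
      qed
      then have "ennreal (Z n \<omega>) \<le> ennreal (g n \<omega> + 1 / K * (Z n \<omega>)\<^sup>2)" by (rule ennreal_leI)
      also have "\<dots> = ennreal (g n \<omega>) + ennreal (1 / K * (Z n \<omega>)\<^sup>2)"
        using g0 K by (intro ennreal_plus) auto
      also have "ennreal (1 / K * (Z n \<omega>)\<^sup>2) = ennreal (1 / K) * ennreal ((Z n \<omega>)\<^sup>2)"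
        using K by (intro ennreal_mult') auto
      finally show "ennreal (Z n \<omega>) \<le> ennreal (g n \<omega>) + ennreal (1 / K) * ennreal ((Z n \<omega>)\<^sup>2)" .
    qed
    also have "\<dots> = (\<integral>\<^sup>+\<omega>. ennreal (g n \<omega>) \<partial>M) + ennreal (1 / K) * (\<integral>\<^sup>+\<omega>. ennreal ((Z n \<omega>)\<^sup>2) \<partial>M)"
      by (simp add: nn_integral_add nn_integral_cmult)
    also have "\<dots> \<le> (\<integral>\<^sup>+\<omega>. ennreal (g n \<omega>) \<partial>M) + ennreal (1 / K) * ennreal (exp (2 * \<Phi>\<^sup>2 * S))"
      by (intro add_mono mult_left_mono sq) auto
    also have "(\<integral>\<^sup>+\<omega>. ennreal (g n \<omega>) \<partial>M) = ennreal (\<integral>\<omega>. g n \<omega> \<partial>M)"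
      using g0 by (intro nn_integral_eq_integral integrable_const_bound[where B=K]) auto
    also have "ennreal (1 / K) * ennreal (exp (2 * \<Phi>\<^sup>2 * S)) = ennreal (exp (2 * \<Phi>\<^sup>2 * S) / K)"
      using K by (simp add: ennreal_mult'[symmetric])
    finally show ?thesis .
  qed
  have bound': "1 \<le> (\<integral>\<omega>. g n \<omega> \<partial>M) + exp (2 * \<Phi>\<^sup>2 * S) / K" for n
  proof -
    have "0 \<le> (\<integral>\<omega>. g n \<omega> \<partial>M)" using g0 by simp
    then have "ennreal 1 \<le> ennreal ((\<integral>\<omega>. g n \<omega> \<partial>M) + exp (2 * \<Phi>\<^sup>2 * S) / K)"
      using bound[of n] K by (simp add: ennreal_plus)
    then show ?thesis using K \<open>0 \<le> (\<integral>\<omega>. g n \<omega> \<partial>M)\<close> by (subst (asm) ennreal_le_iff) (auto intro!: add_nonneg_nonneg)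
  qed
  have lim: "(\<lambda>n. \<integral>\<omega>. g n \<omega> \<partial>M) \<longlonglongrightarrow> (\<integral>\<omega>. min K (exp (\<Phi> * 0) * G \<omega>) \<partial>M)"
  proof (rule integral_dominated_convergence[where w="\<lambda>_. K"])
    show "AE \<omega> in M. (\<lambda>n. g n \<omega>) \<longlonglongrightarrow> min K (exp (\<Phi> * 0) * G \<omega>)"
    proof (rule AE_I2)
      fix \<omega> assume \<omega>: "\<omega> \<in> space M"
      have "(\<lambda>n. ov n \<omega>) \<longlonglongrightarrow> 0"
        unfolding ov_def using \<rho>[OF \<omega>] by (intro overshoot_tendsto_0[OF x S \<omega>]) blast
      then show "(\<lambda>n. g n \<omega>) \<longlonglongrightarrow> min K (exp (\<Phi> * 0) * G \<omega>)"
        unfolding g_def by (intro tendsto_intros)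
    qed
  qed (use g0 in auto)
  have "1 \<le> (\<integral>\<omega>. min K (exp (\<Phi> * 0) * G \<omega>) \<partial>M) + exp (2 * \<Phi>\<^sup>2 * S) / K"
    by (rule LIMSEQ_le_const[OF tendsto_add[OF lim tendsto_const]]) (use bound' in blast)
  also have "(\<integral>\<omega>. min K (exp (\<Phi> * 0) * G \<omega>) \<partial>M) \<le> (\<integral>\<omega>. G \<omega> \<partial>M)"
  proof (rule integral_mono)
    show "integrable M (\<lambda>\<omega>. min K (exp (\<Phi> * 0) * G \<omega>))"
      using K G0 by (intro integrable_const_bound[where B=K]) auto
    have "G \<omega> \<le> exp (x * \<Phi>) * (1 + 1)" for \<omega>
    proof -
      have "exp_neg u (\<tau> \<omega>) \<le> exp_neg u (ereal 0)"
        using u by (intro exp_neg_mono) (auto simp: hitting_time_0_nonneg zero_ereal_def[symmetric])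
      then show ?thesis unfolding G_def using u S by (intro mult_left_mono add_mono) auto
    qed
    then show "integrable M G"
      using G0 by (intro integrable_const_bound[where B="exp (x * \<Phi>) * (1 + 1)"]) auto
  qed auto
  finally show ?thesis by (simp add: G_def)
qed

text \<open>The upper bound closes with \<open>\<delta>\<close> tending to 0 and \<open>S\<close> to
  \<infinity> together. In the lower bound the order matters: the error
  \<open>exp (2 * \<Phi>\<^sup>2 * S) / K\<close> grows with \<open>S\<close>, so \<open>K\<close>
  goes to \<infinity> for fixed \<open>S\<close> before \<open>S\<close> does.\<close>

lemma laplace_hitting:
  assumes x: "0 \<le> x"
  shows "(\<integral>\<^sup>+\<omega>. ennreal (exp_neg u (\<tau> \<omega>)) \<partial>M) = ennreal (exp (- x * \<Phi>))"
proof (cases "x = 0")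
  case True
  have "exp_neg u (\<tau> \<omega>) = 1" if \<omega>: "\<omega> \<in> space M" for \<omega>
  proof -
    have "\<tau> \<omega> \<le> ereal 0"
      unfolding drifted_def using True start_0[OF \<omega>] by (intro hitting_time_0_le) auto
    with hitting_time_0_nonneg[of "\<lambda>t. drifted t \<omega>"] have "\<tau> \<omega> = ereal 0"
      by (simp add: zero_ereal_def)
    then show ?thesis by simp
  qed
  then have "(\<integral>\<^sup>+\<omega>. ennreal (exp_neg u (\<tau> \<omega>)) \<partial>M) = (\<integral>\<^sup>+\<omega>. 1 \<partial>M)"
    by (intro nn_integral_cong) simp
  then show ?thesis using True by (simp add: emeasure_space_1)
next
  case False
  with x have x0: "0 < x" by simp
  have le1: "exp_neg u (\<tau> \<omega>) \<le> 1" for \<omega>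
    using exp_neg_mono[of u "ereal 0" "\<tau> \<omega>"] u hitting_time_0_nonneg[of "\<lambda>t. drifted t \<omega>"] by (simp add: zero_ereal_def)
  have int: "integrable M (\<lambda>\<omega>. exp_neg u (\<tau> \<omega>))"
    using le1 by (intro integrable_const_bound[where B=1]) auto
  define \<phi> where "\<phi> = (\<integral>\<omega>. exp_neg u (\<tau> \<omega>) \<partial>M)"
  have \<phi>: "(\<integral>\<^sup>+\<omega>. ennreal (exp_neg u (\<tau> \<omega>)) \<partial>M) = ennreal \<phi>"
    unfolding \<phi>_def using int by (intro nn_integral_eq_integral) auto
  have eS: "(\<lambda>n. exp (- u * real (Suc n))) \<longlonglongrightarrow> 0"
  proof -
    have "(\<lambda>n. exp (- u) ^ Suc n) \<longlonglongrightarrow> 0"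
      using u by (intro LIMSEQ_Suc LIMSEQ_power_zero) simp
    then show ?thesis by (simp only: exp_of_nat_mult[symmetric] mult.commute)
  qed
  have up: "\<phi> \<le> exp (- (x - inverse (real (Suc n))) * \<Phi>) + exp (- u * real (Suc n))" for n
  proof -
    have "ennreal \<phi> \<le> ennreal (exp (- (x - inverse (real (Suc n))) * \<Phi>) + exp (- u * real (Suc n)))"
      unfolding \<phi>[symmetric] by (rule laplace_hitting_upper[OF x0]) auto
    then show ?thesis by (subst (asm) ennreal_le_iff) (auto intro!: add_nonneg_nonneg)
  qed
  have "(\<lambda>n. exp (- (x - inverse (real (Suc n))) * \<Phi>) + exp (- u * real (Suc n))) \<longlonglongrightarrow> exp (- (x - 0) * \<Phi>) + 0"
    by (intro tendsto_intros eS LIMSEQ_inverse_real_of_nat)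
  then have 1: "\<phi> \<le> exp (- (x - 0) * \<Phi>) + 0"
    by (rule LIMSEQ_le_const) (use up in blast)
  have low: "1 \<le> exp (x * \<Phi>) * (\<phi> + exp (- u * S)) + exp (2 * \<Phi>\<^sup>2 * S) / K" if "0 < S" "0 < K" for S K
    using laplace_hitting_lower_truncated[OF x that] int by (simp add: \<phi>_def prob_space)
  have low': "1 \<le> exp (x * \<Phi>) * (\<phi> + exp (- u * S))" if S: "0 < S" for S
  proof -
    have "(\<lambda>n. exp (x * \<Phi>) * (\<phi> + exp (- u * S)) + exp (2 * \<Phi>\<^sup>2 * S) * inverse (real (Suc n))) \<longlonglongrightarrow> exp (x * \<Phi>) * (\<phi> + exp (- u * S)) + exp (2 * \<Phi>\<^sup>2 * S) * 0"
      by (intro tendsto_intros LIMSEQ_inverse_real_of_nat)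
    moreover have "1 \<le> exp (x * \<Phi>) * (\<phi> + exp (- u * S)) + exp (2 * \<Phi>\<^sup>2 * S) * inverse (real (Suc n))" for n
      unfolding divide_inverse[symmetric] by (rule low[OF S]) simp
    ultimately have "1 \<le> exp (x * \<Phi>) * (\<phi> + exp (- u * S)) + exp (2 * \<Phi>\<^sup>2 * S) * 0"
      by (intro LIMSEQ_le_const) blast+
    then show ?thesis by simp
  qed
  have "(\<lambda>n. exp (x * \<Phi>) * (\<phi> + exp (- u * real (Suc n)))) \<longlonglongrightarrow> exp (x * \<Phi>) * (\<phi> + 0)"
    by (intro tendsto_intros eS)
  moreover have "1 \<le> exp (x * \<Phi>) * (\<phi> + exp (- u * real (Suc n)))" for n
    by (rule low') simp
  ultimately have "1 \<le> exp (x * \<Phi>) * (\<phi> + 0)"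
    by (intro LIMSEQ_le_const) blast+
  then have "1 \<le> exp (x * \<Phi>) * \<phi>" by simp
  then have "exp (- x * \<Phi>) * 1 \<le> exp (- x * \<Phi>) * (exp (x * \<Phi>) * \<phi>)"
    by (intro mult_left_mono) auto
  then have "exp (- x * \<Phi>) \<le> \<phi>" by (simp add: mult.assoc[symmetric] exp_add[symmetric])
  with 1 \<phi> show ?thesis by simp
qed

end

end

subsection \<open>Independence of a variable and a process\<close>

text \<open>Independence says that the pair of \<open>Y\<close> and the identity into
  \<open>F\<close>, the \<open>\<sigma>\<close>-algebra generated by the process, has a product law.
  Staying on the sample space matters: every sample path there may be assumed continuous, whereas on
  the full product space a hitting time depends on uncountably many coordinates.\<close>

lemma (in prob_space) nn_integral_indep_of_process:
  fixes Y :: "'a \<Rightarrow> real" and X :: "real \<Rightarrow> 'a \<Rightarrow> real"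
  defines "F \<equiv> vimage_algebra (space M) (path_of X) (\<Pi>\<^sub>M t\<in>{0..}. borel)"
  assumes indep: "indep_of_process M Y X"
    and Y[measurable]: "random_variable borel Y" and X: "\<And>t. 0 \<le> t \<Longrightarrow> random_variable borel (X t)"
    and f: "f \<in> borel_measurable (borel \<Otimes>\<^sub>M F)"
  shows "(\<integral>\<^sup>+\<omega>. f (Y \<omega>, \<omega>) \<partial>M) = (\<integral>\<^sup>+y. (\<integral>\<^sup>+\<omega>. f (y, \<omega>) \<partial>M) \<partial>distr M borel Y)"
proof -
  have p: "path_of X \<in> M \<rightarrow>\<^sub>M (\<Pi>\<^sub>M t\<in>{0..}. borel)"
    unfolding path_of_def[abs_def] by (intro measurable_restrict X) auto
  have ps: "path_of X \<in> space M \<rightarrow> space (\<Pi>\<^sub>M t\<in>{0..}. borel)"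
    using measurable_space[OF p] by auto
  have id: "(\<lambda>\<omega>. \<omega>) \<in> M \<rightarrow>\<^sub>M F"
    unfolding F_def by (rule measurable_vimage_algebra2[OF _ p]) auto
  have sF: "sets F = {path_of X -` A \<inter> space M |A. A \<in> sets (\<Pi>\<^sub>M t\<in>{0..}. borel)}"
    unfolding F_def by (rule sets_vimage_algebra2[OF ps])
  have spF: "space F = space M" by (simp add: F_def)
  interpret Y: prob_space "distr M borel Y" by (rule prob_space_distr) fact
  interpret F: prob_space "distr M F (\<lambda>\<omega>. \<omega>)" by (rule prob_space_distr) fact
  have pair[measurable]: "(\<lambda>\<omega>. (Y \<omega>, \<omega>)) \<in> M \<rightarrow>\<^sub>M borel \<Otimes>\<^sub>M F"
    using id by measurable
  have eq: "distr M borel Y \<Otimes>\<^sub>M distr M F (\<lambda>\<omega>. \<omega>) = distr M (borel \<Otimes>\<^sub>M F) (\<lambda>\<omega>. (Y \<omega>, \<omega>))"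
  proof (rule pair_measure_eqI)
    fix A B assume "A \<in> sets (distr M borel Y)" "B \<in> sets (distr M F (\<lambda>\<omega>. \<omega>))"
    then have A: "A \<in> sets borel" and B: "B \<in> sets F" by auto
    have Bs: "B \<subseteq> space M" using sets.sets_into_space[OF B] spF by simp
    have "prob ((Y -` A \<inter> space M) \<inter> B) = prob (Y -` A \<inter> space M) * prob B"
      using indep[unfolded indep_of_process_def] A B unfolding sF by (intro indep_setD) auto
    moreover have "(\<lambda>\<omega>. (Y \<omega>, \<omega>)) -` (A \<times> B) \<inter> space M = (Y -` A \<inter> space M) \<inter> B"
      using Bs by auto
    moreover have "(\<lambda>\<omega>. \<omega>) -` B \<inter> space M = B" using Bs by auto
    ultimately show "emeasure (distr M borel Y) A * emeasure (distr M F (\<lambda>\<omega>. \<omega>)) B = emeasure (distr M (borel \<Otimes>\<^sub>M F) (\<lambda>\<omega>. (Y \<omega>, \<omega>))) (A \<times> B)"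
      using A B id by (simp add: emeasure_distr emeasure_eq_measure ennreal_mult'[symmetric])
  qed (auto intro: Y.sigma_finite_measure_axioms F.sigma_finite_measure_axioms)
  have "(\<integral>\<^sup>+\<omega>. f (Y \<omega>, \<omega>) \<partial>M) = (\<integral>\<^sup>+p. f p \<partial>(distr M borel Y \<Otimes>\<^sub>M distr M F (\<lambda>\<omega>. \<omega>)))"
    unfolding eq using f by (simp add: nn_integral_distr)
  also have "\<dots> = (\<integral>\<^sup>+y. (\<integral>\<^sup>+\<omega>. f (y, \<omega>) \<partial>distr M F (\<lambda>\<omega>. \<omega>)) \<partial>distr M borel Y)"
    using f by (intro F.nn_integral_fst[symmetric]) simp
  also have "\<dots> = (\<integral>\<^sup>+y. (\<integral>\<^sup>+\<omega>. f (y, \<omega>) \<partial>M) \<partial>distr M borel Y)"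
    using f id by (intro nn_integral_cong) (simp add: nn_integral_distr)
  finally show ?thesis .
qed

lemma measurable_process_vimage_algebra:
  "0 \<le> t \<Longrightarrow> X t \<in> borel_measurable (vimage_algebra S (path_of X) (\<Pi>\<^sub>M t\<in>{0..}. (borel :: real measure)))"
proof -
  assume t: "0 \<le> t"
  have "path_of X \<in> vimage_algebra S (path_of X) (\<Pi>\<^sub>M t\<in>{0..}. (borel :: real measure)) \<rightarrow>\<^sub>M (\<Pi>\<^sub>M t\<in>{0..}. borel)"
    by (rule measurable_vimage_algebra1) (auto simp: path_of_def space_PiM)
  from measurable_compose[OF this measurable_component_singleton[of t]] t show ?thesis
    by (simp add: path_of_def)
qed

text \<open>\<open>T\<close> is approximated from the right by times with countably many values. The
  \<open>+ 1\<close> after the floor keeps them strictly larger than \<open>T\<close>, even when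
  \<open>T\<close> is itself a grid point, so that they converge in
  \<open>at_right (T \<omega>)\<close>.\<close>

lemma borel_measurable_right_continuous_eval:
  fixes X :: "real \<Rightarrow> 'a \<Rightarrow> real"
  assumes X: "\<And>t. 0 \<le> t \<Longrightarrow> X t \<in> borel_measurable N"
    and T[measurable]: "T \<in> borel_measurable N" and T0: "\<And>\<omega>. \<omega> \<in> space N \<Longrightarrow> 0 \<le> T \<omega>"
    and rc: "\<And>\<omega> t. \<omega> \<in> space N \<Longrightarrow> 0 \<le> t \<Longrightarrow> continuous (at_right t) (\<lambda>s. X s \<omega>)"
  shows "(\<lambda>\<omega>. X (T \<omega>) \<omega>) \<in> borel_measurable N"
proof (rule borel_measurable_LIMSEQ_real)
  define d where "d n = 1 / real (Suc n)" for n
  define k where "k n \<omega> = nat \<lfloor>T \<omega> / d n\<rfloor> + 1" for n \<omega>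
  have d: "0 < d n" for n by (simp add: d_def)
  have [measurable]: "k n \<in> N \<rightarrow>\<^sub>M count_space UNIV" for n
    unfolding k_def by measurable
  show "(\<lambda>\<omega>. X (real (k n \<omega>) * d n) \<omega>) \<in> borel_measurable N" for n
    by (rule measurable_compose_countable[where f="\<lambda>k. X (real k * d n)" and g="k n"])
       (auto intro!: X mult_nonneg_nonneg less_imp_le[OF d])
  fix \<omega> assume \<omega>: "\<omega> \<in> space N"
  have b: "T \<omega> < real (k n \<omega>) * d n" "real (k n \<omega>) * d n \<le> T \<omega> + d n" for n
  proof -
    have "0 \<le> T \<omega> / d n" using T0[OF \<omega>] d[of n] by simp
    then have "real (k n \<omega>) = of_int \<lfloor>T \<omega> / d n\<rfloor> + 1" by (simp add: k_def)
    then have "T \<omega> / d n < real (k n \<omega>)" "real (k n \<omega>) \<le> T \<omega> / d n + 1" by linarith+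
    then show "T \<omega> < real (k n \<omega>) * d n" "real (k n \<omega>) * d n \<le> T \<omega> + d n"
      using d[of n] by (auto simp: field_simps)
  qed
  have dl: "d \<longlonglongrightarrow> 0" unfolding d_def using LIMSEQ_inverse_real_of_nat by (simp add: inverse_eq_divide)
  have "(\<lambda>n. real (k n \<omega>) * d n) \<longlonglongrightarrow> T \<omega>"
  proof (rule tendsto_sandwich[where f="\<lambda>_. T \<omega>" and h="\<lambda>n. T \<omega> + d n"])
    show "(\<lambda>n. T \<omega> + d n) \<longlonglongrightarrow> T \<omega>" using tendsto_add[OF tendsto_const dl] by simp
  qed (auto simp: b less_imp_le[OF b(1)])
  moreover have "real (k n \<omega>) * d n \<noteq> T \<omega>" for n using b(1)[of n] by simp
  ultimately have "filterlim (\<lambda>n. real (k n \<omega>) * d n) (at_right (T \<omega>)) sequentially"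
    using b(1) by (auto simp: filterlim_at intro!: always_eventually)
  moreover have "((\<lambda>s. X s \<omega>) \<longlongrightarrow> X (T \<omega>) \<omega>) (at_right (T \<omega>))"
    using rc[OF \<omega> T0[OF \<omega>]] by (simp add: continuous_within)
  ultimately show "(\<lambda>n. X (real (k n \<omega>) * d n) \<omega>) \<longlonglongrightarrow> X (T \<omega>) \<omega>"
    by (rule filterlim_compose[rotated])
qed

subsection \<open>Random exponential levels\<close>

text \<open>On [0, \<infinity>] the map \<open>exp_neg 1\<close> is injective with values in [0, 1],
  and its n-th power is \<open>exp_neg n\<close>, so the hypothesis is a moment problem for a
  bounded variable.\<close>

lemma nonneg_ereal_laplace_unique:
  fixes T1 :: "'a \<Rightarrow> ereal" and T2 :: "'b \<Rightarrow> ereal"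
  assumes "prob_space M" "prob_space N"
    and [measurable]: "T1 \<in> borel_measurable M" "T2 \<in> borel_measurable N"
    and T1: "\<And>\<omega>. \<omega> \<in> space M \<Longrightarrow> 0 \<le> T1 \<omega>" and T2: "\<And>\<omega>. \<omega> \<in> space N \<Longrightarrow> 0 \<le> T2 \<omega>"
    and eq: "\<And>n. 0 < n \<Longrightarrow> (\<integral>\<^sup>+\<omega>. ennreal (exp_neg (real n) (T1 \<omega>)) \<partial>M) = (\<integral>\<^sup>+\<omega>. ennreal (exp_neg (real n) (T2 \<omega>)) \<partial>N)"
  shows "distr M borel T1 = distr N borel T2"
proof -
  interpret M: prob_space M by fact
  interpret N: prob_space N by fact
  \<comment> \<open>At \<infinity> the power with \<open>n = 0\<close> is 1 while
    \<open>exp_neg 0\<close> is 0, so the zeroth moment is settled separately by the total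
    mass.\<close>
  have pow: "exp_neg 1 t ^ n = exp_neg (real n) t" if "0 < n" for n t
    using that by (cases t) (auto simp: exp_neg_def exp_of_nat_mult[symmetric])
  have le1: "exp_neg 1 t \<le> 1" if "0 \<le> t" for t
    using that exp_neg_mono[of 1 "ereal 0" t] by (simp add: zero_ereal_def)
  have "distr M borel (\<lambda>\<omega>. exp_neg 1 (T1 \<omega>)) = distr N borel (\<lambda>\<omega>. exp_neg 1 (T2 \<omega>))"
  proof (rule bounded_moments_unique)
    fix n :: nat
    show "(\<integral>\<omega>. exp_neg 1 (T1 \<omega>) ^ n \<partial>M) = (\<integral>\<omega>. exp_neg 1 (T2 \<omega>) ^ n \<partial>N)"
    proof (cases "n = 0")
      case True
      then show ?thesis by (simp add: M.prob_space N.prob_space)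
    next
      case False
      then have n: "0 < n" by simp
      show ?thesis using eq[OF n] by (simp add: pow[OF n] integral_eq_nn_integral)
    qed
  qed (use assms T1 T2 le1 in auto)
  then have "distr (distr M borel (\<lambda>\<omega>. exp_neg 1 (T1 \<omega>))) borel (\<lambda>y. if y \<le> 0 then \<infinity> else ereal (- ln y))
    = distr (distr N borel (\<lambda>\<omega>. exp_neg 1 (T2 \<omega>))) borel (\<lambda>y. if y \<le> 0 then \<infinity> else ereal (- ln y))"
    by simp
  moreover have inv: "(if exp_neg 1 t \<le> 0 then \<infinity> else ereal (- ln (exp_neg 1 t))) = t" if "0 \<le> t" for t
    using that by (cases t) auto
  have "distr (distr M borel (\<lambda>\<omega>. exp_neg 1 (T1 \<omega>))) borel (\<lambda>y. if y \<le> 0 then \<infinity> else ereal (- ln y)) = distr M borel T1"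
    by (subst distr_distr) (auto simp: o_def inv T1 intro!: distr_cong)
  moreover have "distr (distr N borel (\<lambda>\<omega>. exp_neg 1 (T2 \<omega>))) borel (\<lambda>y. if y \<le> 0 then \<infinity> else ereal (- ln y)) = distr N borel T2"
    by (subst distr_distr) (auto simp: o_def inv T2 intro!: distr_cong)
  ultimately show ?thesis by simp
qed

context prob_space
begin

lemma exponential_with_mean_density:
  assumes "exponential_with_mean M X (1 / l)"
  shows "distributed M lborel X (exponential_density l)"
proof -
  obtain k where k: "0 < k" "distributed M lborel X (exponential_density k)" "expectation X = 1 / l"
    using assms by (auto simp: exponential_with_mean_def)
  with exponential_distributed_expectation[OF k(1,2)] have "k = l" by simp
  with k show ?thesis by simp
qed

lemma exponential_distributed_nonneg_AE:
  assumes "distributed M lborel X (exponential_density l)"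
  shows "AE \<omega> in M. 0 \<le> X \<omega>"
proof -
  have "AE x in density lborel (exponential_density l). 0 \<le> x"
    by (subst AE_density) (auto simp: exponential_density_def)
  then have "AE x in distr M lborel X. 0 \<le> x"
    by (simp only: distributed_distr_eq_density[OF assms])
  then show ?thesis
    by (subst (asm) AE_distr_iff) (use distributed_measurable[OF assms] in auto)
qed

text \<open>Shared by the hitting time and the subordinator, both with \<open>c\<close> the tempered
  exponent at \<open>u\<close>. An exponential variable is nonnegative only almost surely, and the
  conditional transform is given for nonnegative levels only; \<open>max 0\<close> reconciles the
  two.\<close>

lemma nn_integral_exponential_mixture:
  fixes Y :: "'a \<Rightarrow> real"
  assumes Y: "distributed M lborel Y (exponential_density l)" and l: "0 < l" and c: "0 \<le> c"
    and indep: "indep_of_process M Y X" and X: "\<And>t. 0 \<le> t \<Longrightarrow> random_variable borel (X t)"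
    and f[measurable]: "f \<in> borel_measurable (borel \<Otimes>\<^sub>M vimage_algebra (space M) (path_of X) (\<Pi>\<^sub>M t\<in>{0..}. borel))"
    and eq: "\<And>x. 0 \<le> x \<Longrightarrow> (\<integral>\<^sup>+\<omega>. f (x, \<omega>) \<partial>M) = ennreal (exp (- x * c))"
  shows "(\<integral>\<^sup>+\<omega>. f (max 0 (Y \<omega>), \<omega>) \<partial>M) = ennreal (l / (l + c))"
proof -
  have [measurable]: "random_variable borel Y"
    using distributed_measurable[OF Y] by simp
  have "(\<lambda>p. f (max 0 (fst p), snd p)) \<in> borel_measurable (borel \<Otimes>\<^sub>M vimage_algebra (space M) (path_of X) (\<Pi>\<^sub>M t\<in>{0..}. borel))"
    by measurable
  from nn_integral_indep_of_process[OF indep _ X this]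
  have "(\<integral>\<^sup>+\<omega>. f (max 0 (Y \<omega>), \<omega>) \<partial>M) = (\<integral>\<^sup>+y. ennreal (exp (- max 0 y * c)) \<partial>distr M borel Y)"
    by (simp add: eq)
  also have "\<dots> = (\<integral>\<^sup>+\<omega>. ennreal (exp (- max 0 (Y \<omega>) * c)) \<partial>M)"
    by (subst nn_integral_distr) auto
  also have "\<dots> = (\<integral>\<^sup>+x. ennreal (exponential_density l x) * ennreal (exp (- max 0 x * c)) \<partial>lborel)"
    by (rule distributed_nn_integral[OF Y, symmetric]) measurable
  also have "\<dots> = (\<integral>\<^sup>+x. ennreal (exponential_density l x) * ennreal (exp (- x * c)) \<partial>lborel)"
    by (intro nn_integral_cong) (auto simp: exponential_density_def)
  also have "\<dots> = ennreal (l / (l + c))"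
    by (rule nn_integral_exp_exponential_density[OF l c])
  finally show ?thesis .
qed

end

section \<open>The transforms of the excursion time, the subordinated time and the density\<close>

lemma laplace_hitting_exponential_level:
  assumes "brownian_motion_2 M B" and Y: "distributed M lborel Y (exponential_density l)" and l: "0 < l"
    and indep: "indep_of_process M Y B" and m: "0 < m" and u: "0 < u"
  shows "(\<integral>\<^sup>+\<omega>. ennreal (exp_neg u (hitting_time_0 (\<lambda>t. Y \<omega> + (- m) * t + B t \<omega>))) \<partial>M)
    = ennreal (l / (l + tempered_exponent ((m / 2)\<^sup>2) u))"
proof -
  interpret brownian_motion_2 M B by fact
  let ?F = "vimage_algebra (space M) (path_of B) (\<Pi>\<^sub>M t\<in>{0..}. borel)"
  define f where "f p = ennreal (exp_neg u (hitting_time_0 (\<lambda>t. fst p + (- m) * t + B t (snd p))))" for p :: "real \<times> 'a"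
  have Bm: "0 \<le> t \<Longrightarrow> B t \<in> borel_measurable ?F" for t
    by (rule measurable_process_vimage_algebra)
  \<comment> \<open>Joint measurability in level and sample point comes from reading the excursion
    as one continuous process on the product of the level space and the sample space.\<close>
  have [measurable]: "(\<lambda>p. hitting_time_0 (\<lambda>t. fst p + (- m) * t + B t (snd p))) \<in> borel_measurable (borel \<Otimes>\<^sub>M ?F)"
    by (rule borel_measurable_hitting_time_0)
       (auto simp: space_pair_measure intro!: borel_measurable_add measurable_compose[OF measurable_snd Bm] continuous_intros continuous_paths)
  have fm: "f \<in> borel_measurable (borel \<Otimes>\<^sub>M ?F)"
    unfolding f_def by measurable
  have "(\<integral>\<^sup>+\<omega>. ennreal (exp_neg u (hitting_time_0 (\<lambda>t. Y \<omega> + (- m) * t + B t \<omega>))) \<partial>M)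
      = (\<integral>\<^sup>+\<omega>. f (max 0 (Y \<omega>), \<omega>) \<partial>M)"
    using exponential_distributed_nonneg_AE[OF Y] by (intro nn_integral_cong_AE) (auto simp: f_def max_def)
  also have "\<dots> = ennreal (l / (l + tempered_exponent ((m / 2)\<^sup>2) u))"
    using laplace_hitting[OF m u]
    by (intro nn_integral_exponential_mixture[OF Y l exponent_pos[OF m u] indep measurable_at fm])
       (auto simp: f_def drifted_def[OF m u])
  finally show ?thesis .
qed

lemma laplace_subordinator_exponential_time:
  assumes "tempered_stable_subordinator M ((m / 2)\<^sup>2) H" and Y: "distributed M lborel Y (exponential_density l)" and l: "0 < l"
    and Y0: "\<And>\<omega>. \<omega> \<in> space M \<Longrightarrow> 0 \<le> Y \<omega>"
    and indep: "indep_of_process M Y H" and u: "0 < u"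
  shows "(\<integral>\<^sup>+\<omega>. ennreal (exp (- u * H (Y \<omega>) \<omega>)) \<partial>M) = ennreal (l / (l + tempered_exponent ((m / 2)\<^sup>2) u))"
proof -
  interpret tempered_stable_subordinator M "(m / 2)\<^sup>2" H by fact
  let ?F = "vimage_algebra (space M) (path_of H) (\<Pi>\<^sub>M t\<in>{0..}. borel)"
  define f where "f p = ennreal (exp (- u * H (max 0 (fst p)) (snd p)))" for p :: "real \<times> 'a"
  have "(\<lambda>p. H (max 0 (fst p)) (snd p)) \<in> borel_measurable (borel \<Otimes>\<^sub>M ?F)"
    by (rule borel_measurable_right_continuous_eval[where X="\<lambda>t p. H t (snd p)" and T="\<lambda>p. max 0 (fst p)"])
       (auto simp: space_pair_measure intro!: measurable_compose[OF measurable_snd measurable_process_vimage_algebra] right_continuous_paths)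
  then have fm: "f \<in> borel_measurable (borel \<Otimes>\<^sub>M ?F)"
    unfolding f_def by measurable
  have \<Phi>: "0 \<le> tempered_exponent ((m / 2)\<^sup>2) u"
    using u by (intro tempered_exponent_nonneg) simp
  have "(\<integral>\<^sup>+\<omega>. ennreal (exp (- u * H (Y \<omega>) \<omega>)) \<partial>M) = (\<integral>\<^sup>+\<omega>. f (max 0 (Y \<omega>), \<omega>) \<partial>M)"
    using Y0 by (intro nn_integral_cong) (simp add: f_def max_def)
  also have "\<dots> = ennreal (l / (l + tempered_exponent ((m / 2)\<^sup>2) u))"
  proof (rule nn_integral_exponential_mixture[OF Y l \<Phi> indep measurable_at fm])
    fix x :: real assume x: "0 \<le> x"
    \<comment> \<open>The Bochner integral of a non-integrable function is 0, while the transform is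
      an exponential and hence positive.\<close>
    have "integrable M (\<lambda>\<omega>. exp (- u * H x \<omega>))"
      using laplace[OF x u] not_integrable_integral_eq by fastforce
    then have "(\<integral>\<^sup>+\<omega>. ennreal (exp (- u * H x \<omega>)) \<partial>M) = ennreal (exp (- x * tempered_exponent ((m / 2)\<^sup>2) u))"
      unfolding laplace[OF x u, symmetric] by (intro nn_integral_eq_integral) auto
    then show "(\<integral>\<^sup>+\<omega>. f (x, \<omega>) \<partial>M) = ennreal (exp (- x * tempered_exponent ((m / 2)\<^sup>2) u))"
      using x by (simp add: f_def max_def)
  qed
  finally show ?thesis .
qed

text \<open>Exchanging the integrals puts the time integral for a fixed level inside, where the
  inverse Gaussian transform applies; the level is then averaged. The case \<open>u = 0\<close> is
  included because it gives the total mass.\<close>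

lemma nn_integral_exp_inverse_gaussian_mixture:
  fixes m l u :: real
  assumes m: "0 < m" and l: "0 < l" and u: "0 \<le> u"
  shows "(\<integral>\<^sup>+z. indicator {0<..} z * (\<integral>\<^sup>+x\<in>{0<..}. ennreal (x / z * (exp (- (x - m * z)\<^sup>2 / (4 * z)) / sqrt (4 * pi * z))
      * l * exp (- x * l)) \<partial>lborel) * ennreal (exp (- u * z)) \<partial>lborel)
    = ennreal (l / (l + tempered_exponent ((m / 2)\<^sup>2) u))"
proof -
  define g where "g x z = x / z * (exp (- (x - m * z)\<^sup>2 / (4 * z)) / sqrt (4 * pi * z))" for x z :: real
  have [measurable]: "(\<lambda>p. g (fst p) (snd p)) \<in> borel_measurable (borel \<Otimes>\<^sub>M borel)"
    unfolding g_def by measurable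
  have g0: "0 \<le> g x z" if "0 < x" "0 < z" for x z
    using that by (simp add: g_def)
  define k where "k x z = ennreal (exponential_density l x) * (ennreal (g x z * exp (- u * z)) * indicator {0<..} z) * indicator {0<..} x" for x z
  have km: "(\<lambda>(x, z). k x z) \<in> borel_measurable (lborel \<Otimes>\<^sub>M lborel)"
    unfolding k_def split_beta' by measurable
  have \<Phi>: "0 \<le> tempered_exponent ((m / 2)\<^sup>2) u"
    using u by (intro tempered_exponent_nonneg) simp
  have "indicator {0<..} z * (\<integral>\<^sup>+x\<in>{0<..}. ennreal (g x z * l * exp (- x * l)) \<partial>lborel) * ennreal (exp (- u * z))
      = (\<integral>\<^sup>+x. k x z \<partial>lborel)" for z
  proof -
    have [measurable]: "(\<lambda>x. g x z) \<in> borel_measurable borel" unfolding g_def by measurable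
    have "indicator {0<..} z * (\<integral>\<^sup>+x\<in>{0<..}. ennreal (g x z * l * exp (- x * l)) \<partial>lborel) * ennreal (exp (- u * z))
      = (\<integral>\<^sup>+x. indicator {0<..} z * (ennreal (g x z * l * exp (- x * l)) * indicator {0<..} x) * ennreal (exp (- u * z)) \<partial>lborel)"
      by (simp add: nn_integral_cmult nn_integral_multc)
    also have "\<dots> = (\<integral>\<^sup>+x. k x z \<partial>lborel)"
    proof (intro nn_integral_cong)
      fix x :: real
      show "indicator {0<..} z * (ennreal (g x z * l * exp (- x * l)) * indicator {0<..} x) * ennreal (exp (- u * z)) = k x z"
      proof (cases "0 < x \<and> 0 < z")
        case True
        have "g x z * l * exp (- x * l) * exp (- u * z) = exponential_density l x * (g x z * exp (- u * z))"
          using True by (simp add: exponential_density_def mult_ac)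
        then have "ennreal (g x z * l * exp (- x * l)) * ennreal (exp (- u * z)) = ennreal (exponential_density l x) * ennreal (g x z * exp (- u * z))"
          using l by (simp only: ennreal_mult''[symmetric] ennreal_mult'[symmetric] exp_ge_zero exponential_density_nonneg)
        then show ?thesis using True by (simp add: k_def)
      qed (auto simp: k_def indicator_def)
    qed
    finally show ?thesis .
  qed
  then have "(\<integral>\<^sup>+z. indicator {0<..} z * (\<integral>\<^sup>+x\<in>{0<..}. ennreal (g x z * l * exp (- x * l)) \<partial>lborel) * ennreal (exp (- u * z)) \<partial>lborel)
    = (\<integral>\<^sup>+z. \<integral>\<^sup>+x. k x z \<partial>lborel \<partial>lborel)" by simp
  also have "\<dots> = (\<integral>\<^sup>+x. \<integral>\<^sup>+z. k x z \<partial>lborel \<partial>lborel)"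
    by (rule lborel_pair.Fubini'[OF km])
  also have "\<dots> = (\<integral>\<^sup>+x. ennreal (exponential_density l x) * ennreal (exp (- x * tempered_exponent ((m / 2)\<^sup>2) u)) \<partial>lborel)"
  proof (rule nn_integral_cong_AE)
    \<comment> \<open>The level 0 is the only exception: \<open>k\<close> vanishes there, but the
      exponential density equals \<open>l\<close>.\<close>
    show "AE x in lborel. (\<integral>\<^sup>+z. k x z \<partial>lborel) = ennreal (exponential_density l x) * ennreal (exp (- x * tempered_exponent ((m / 2)\<^sup>2) u))"
      using AE_lborel_singleton[of 0]
    proof eventually_elim
      case (elim x)
      have [measurable]: "(\<lambda>z. g x z) \<in> borel_measurable borel" unfolding g_def by measurable
      show ?case
      proof (cases "0 < x")
        case True
        then have "(\<integral>\<^sup>+z. k x z \<partial>lborel) = ennreal (exponential_density l x) * (\<integral>\<^sup>+z. ennreal (g x z * exp (- u * z)) * indicator {0<..} z \<partial>lborel)"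
          unfolding k_def by (simp add: nn_integral_cmult)
        then show ?thesis
          using nn_integral_exp_inverse_gaussian[OF True m u] by (simp add: g_def)
      next
        case False
        then show ?thesis using elim by (simp add: k_def exponential_density_def)
      qed
    qed
  qed
  also have "\<dots> = ennreal (l / (l + tempered_exponent ((m / 2)\<^sup>2) u))"
    by (rule nn_integral_exp_exponential_density[OF l \<Phi>])
  finally show ?thesis by (simp add: g_def)
qed

theorem theorem6p1:
  fixes M :: "'a measure" and M' :: "'b measure"
    and N r i :: nat and m \<sigma> :: "nat \<Rightarrow> real" and reg :: "nat \<Rightarrow> nat"
    and L D :: "nat \<Rightarrow> 'a \<Rightarrow> real" and B :: "nat \<Rightarrow> real \<Rightarrow> 'a \<Rightarrow> real"
    and E :: "real \<Rightarrow> 'a \<Rightarrow> real"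
    and H :: "real \<Rightarrow> 'b \<Rightarrow> real" and h :: "'b \<Rightarrow> real"
  assumes "r \<in> {1..N}"
    and "energy_accumulation M N m \<sigma> reg L B D E"
    and "reg i = r"
    and "tempered_stable_subordinator M' ((m r / 2)\<^sup>2) H"
    and "exponential_with_mean M' h (m r / \<sigma> r)"
    and "\<forall>\<omega>\<in>space M'. 0 \<le> h \<omega>"
    and "indep_of_process M' h H"
  shows "eq_in_distribution M (accumulation_time m reg L B i)
           M' (\<lambda>\<omega>. ereal (H (h \<omega>) \<omega>)) borel \<and>
         distributed M lborel (\<lambda>\<omega>. real_of_ereal (accumulation_time m reg L B i \<omega>))
           (\<lambda>z. indicator {0<..} z *
              (\<integral>\<^sup>+ x \<in> {0<..}. ennreal (x / z * (exp (- (x - m r * z)\<^sup>2 / (4 * z)) / sqrt (4 * pi * z))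
                 * (\<sigma> r / m r) * exp (- x * (\<sigma> r / m r))) \<partial>lborel))"
proof -
  interpret A: energy_accumulation M N m \<sigma> reg L B D E by fact
  interpret B: brownian_motion_2 M "B i" by (rule A.driving_motion)
  interpret H: tempered_stable_subordinator M' "(m r / 2)\<^sup>2" H by fact
  define l where "l = \<sigma> r / m r"
  have m: "0 < m r" and l: "0 < l"
    using A.m_pos[OF assms(1)] A.\<sigma>_pos[OF assms(1)] by (auto simp: l_def)
  have mean: "m r / \<sigma> r = 1 / l" by (simp add: l_def)
  have Li: "distributed M lborel (L i) (exponential_density l)"
    using A.level_law[of i] by (intro A.exponential_with_mean_density) (simp add: assms(3) mean)
  have h: "distributed M' lborel h (exponential_density l)"
    using assms(5) by (intro H.exponential_with_mean_density) (simp add: mean)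
  have [measurable]: "L i \<in> borel_measurable M" "h \<in> borel_measurable M'"
    using distributed_measurable[OF Li] distributed_measurable[OF h] by auto
  define \<tau> where "\<tau> = accumulation_time m reg L B i"
  have \<tau>: "\<tau> \<omega> = hitting_time_0 (\<lambda>t. L i \<omega> + (- m r) * t + B i t \<omega>)" for \<omega>
    by (simp add: \<tau>_def accumulation_time_def excursion_def assms(3))
  have \<tau>m[measurable]: "\<tau> \<in> borel_measurable M"
    unfolding \<tau>[abs_def]
    by (rule borel_measurable_hitting_time_0)
       (auto intro!: borel_measurable_add B.measurable_at continuous_intros B.continuous_paths)
  have Hm[measurable]: "(\<lambda>\<omega>. H (h \<omega>) \<omega>) \<in> borel_measurable M'"
  proof (rule borel_measurable_right_continuous_eval[where X=H and T=h])
    show "H t \<in> borel_measurable M'" if "0 \<le> t" for t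
      using that by (rule H.measurable_at)
    show "continuous (at_right t) (\<lambda>s. H s \<omega>)" if "\<omega> \<in> space M'" "0 \<le> t" for \<omega> t
      using that by (rule H.right_continuous_paths)
  qed (use assms(6) in simp_all)
  have H0: "0 \<le> H (h \<omega>) \<omega>" if \<omega>: "\<omega> \<in> space M'" for \<omega>
  proof -
    have "H 0 \<omega> \<le> H (h \<omega>) \<omega>"
      using assms(6) \<omega> by (intro mono_onD[OF H.nondecreasing_paths[OF \<omega>]]) auto
    then show ?thesis by (simp only: H.start_0[OF \<omega>])
  qed
  define d where "d z = indicator {0<..} z * (\<integral>\<^sup>+ x \<in> {0<..}. ennreal (x / z * (exp (- (x - m r * z)\<^sup>2 / (4 * z)) / sqrt (4 * pi * z))
                 * l * exp (- x * l)) \<partial>lborel)" for z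
  have [measurable]: "d \<in> borel_measurable borel"
    unfolding d_def by measurable
  have d_laplace: "(\<integral>\<^sup>+z. d z * ennreal (exp (- u * z)) \<partial>lborel) = ennreal (l / (l + tempered_exponent ((m r / 2)\<^sup>2) u))" if "0 \<le> u" for u
    unfolding d_def by (rule nn_integral_exp_inverse_gaussian_mixture[OF m l that])
  define \<nu> where "\<nu> = density lborel d"
  have [measurable_cong]: "sets \<nu> = sets borel" by (simp add: \<nu>_def)
  have \<nu>: "prob_space \<nu>"
  proof
    \<comment> \<open>At \<open>u = 0\<close> the tempered exponent vanishes and the transform is
      \<open>l / l\<close>.\<close>
    show "emeasure \<nu> (space \<nu>) = 1"
      using d_laplace[of 0] l by (simp add: \<nu>_def emeasure_density tempered_exponent_def)
  qed
  have \<tau>_laplace: "(\<integral>\<^sup>+\<omega>. ennreal (exp_neg u (\<tau> \<omega>)) \<partial>M) = ennreal (l / (l + tempered_exponent ((m r / 2)\<^sup>2) u))" if "0 < u" for u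
    unfolding \<tau>
    by (rule laplace_hitting_exponential_level[OF A.driving_motion Li l A.indep_level_motion m that])
  have "distr M borel \<tau> = distr M' borel (\<lambda>\<omega>. ereal (H (h \<omega>) \<omega>))"
  proof (rule nonneg_ereal_laplace_unique)
    fix n :: nat assume "0 < n"
    then show "(\<integral>\<^sup>+\<omega>. ennreal (exp_neg n (\<tau> \<omega>)) \<partial>M) = (\<integral>\<^sup>+\<omega>. ennreal (exp_neg n (ereal (H (h \<omega>) \<omega>))) \<partial>M')"
      using laplace_subordinator_exponential_time[OF assms(4) h l _ assms(7), of n] assms(6)
      by (simp add: \<tau>_laplace)
  qed (use H0 in \<open>auto simp: \<tau> hitting_time_0_nonneg A.prob_space_axioms H.prob_space_axioms\<close>)
  then have 1: "eq_in_distribution M \<tau> M' (\<lambda>\<omega>. ereal (H (h \<omega>) \<omega>)) borel"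
    by (simp add: eq_in_distribution_def)
  \<comment> \<open>The uniqueness lemma asks for pointwise nonnegativity, so \<open>z\<close> is
    cut at 0; \<open>\<nu>\<close> lives on the positive reals, so the cut does not alter its
    law.\<close>
  have "distr M borel \<tau> = distr \<nu> borel (\<lambda>z. ereal (max 0 z))"
  proof (rule nonneg_ereal_laplace_unique)
    fix n :: nat assume n: "0 < n"
    have "(\<integral>\<^sup>+z. ennreal (exp_neg n (ereal (max 0 z))) \<partial>\<nu>) = (\<integral>\<^sup>+z. d z * ennreal (exp (- real n * max 0 z)) \<partial>lborel)"
      unfolding \<nu>_def exp_neg_simps by (subst nn_integral_density) auto
    also have "\<dots> = (\<integral>\<^sup>+z. d z * ennreal (exp (- real n * z)) \<partial>lborel)"
      by (intro nn_integral_cong) (auto simp: d_def indicator_def)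
    finally show "(\<integral>\<^sup>+\<omega>. ennreal (exp_neg n (\<tau> \<omega>)) \<partial>M) = (\<integral>\<^sup>+z. ennreal (exp_neg n (ereal (max 0 z))) \<partial>\<nu>)"
      using n by (simp only: d_laplace \<tau>_laplace of_nat_0_less_iff of_nat_0_le_iff)
  next
    show "0 \<le> ereal (max 0 z)" for z
      by (simp only: zero_ereal_def ereal_less_eq max.cobounded1)
  qed (auto simp: \<tau> hitting_time_0_nonneg A.prob_space_axioms \<nu>)
  \<comment> \<open>The right-hand variable takes only finite values, so the equality of laws makes
    \<open>\<tau>\<close> almost surely finite, and \<open>real_of_ereal\<close> loses
    nothing.\<close>
  then have "distr (distr M borel \<tau>) lborel real_of_ereal = distr (distr \<nu> borel (\<lambda>z. ereal (max 0 z))) lborel real_of_ereal"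
    by simp
  then have "distr M lborel (\<lambda>\<omega>. real_of_ereal (\<tau> \<omega>)) = distr \<nu> lborel (\<lambda>z. max 0 z)"
    by (simp add: distr_distr o_def del: ereal_max)
  also have "\<dots> = distr \<nu> \<nu> (\<lambda>z. z)"
  proof (rule distr_cong_AE)
    show "AE z in \<nu>. max 0 z = z"
      unfolding \<nu>_def by (subst AE_density) (auto simp: d_def indicator_def)
  qed (auto simp: \<nu>_def)
  also have "\<dots> = density lborel d" by (simp add: \<nu>_def)
  finally have "distributed M lborel (\<lambda>\<omega>. real_of_ereal (\<tau> \<omega>)) d"
    by (simp add: distributed_def)
  with 1 show ?thesis
    unfolding \<tau>_def d_def[abs_def] l_def by (intro conjI)
qed

end
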